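(* Let $B$ be a compact region in $\mathbb{R}^r$, let $\mathfrak{X}$ be a closed subscheme of $\mathbb{A}^r_{\mathbb{Z}}$ of codimension $a \geq 1$, let $\lambda$ be a positive real number, let $m$ be a positive integer, let $x_0 \in \mathbb{Z}^r$, and let $P$ be any real number with $P > \lambda/m > 1$. Then for every $\epsilon > 0$, $$\# \left\{ (x, p) \ : \ x \in \lambda B \cap (x_0 + m\mathbb{Z}^r), \ p \text{ is a prime in } [P, 2P], \ p \nmid m, \ x \ (\mathrm{mod}\ p) \in \mathfrak{X}(\mathbb{F}_p) \right\} \ll_{B, \mathfrak{X}, \epsilon} \left( \frac{\lambda}{m} \right)^{r - a} P \lambda^{\epsilon}.$$
   Context: $\lambda B=\{\lambda b : b\in B\}$. The notation $\ll_{B,\mathfrak{X},\epsilon}$ means that the left side is at most a constant depending only on $B$, $\mathfrak{X}$ and $\epsilon$ (in particular not on $\lambda, m, x_0, P$) times the right side. *)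

theory Defs
  imports
    "HOL-Analysis.Analysis"
    "HOL-Library.Poly_Mapping"
    "HOL-Library.Extended_Nat"
    "HOL-Algebra.Algebraic_Closure_Type"
    "HOL-Number_Theory.Number_Theory"
begin

unbundle no fps_syntax

text \<open>
  Integer polynomials in finitely many variables indexed by \<open>'n\<close>: finitely supported maps from
  exponent vectors to coefficients, with the convolution product of \<open>Poly_Mapping\<close>.
\<close>

type_synonym 'n int_mpoly = "('n \<Rightarrow>\<^sub>0 nat) \<Rightarrow>\<^sub>0 int"

definition eval_int_mpoly :: "'n::finite int_mpoly \<Rightarrow> int ^ 'n \<Rightarrow> int" where
  "eval_int_mpoly f x =
     (\<Sum>k\<in>Poly_Mapping.keys f.
        Poly_Mapping.lookup f k * (\<Prod>i\<in>UNIV. (x $ i) ^ Poly_Mapping.lookup k i))"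

text \<open>
  The closed subschemes of affine \<open>r\<close>-space over the integers are the \<open>Spec\<close> of the quotients of
  the polynomial ring by an ideal, so a closed subscheme is represented by its ideal.
\<close>

definition closed_subscheme :: "'n::finite int_mpoly set \<Rightarrow> bool" where
  "closed_subscheme I \<longleftrightarrow> ideal I (ring_of_type_algebra :: 'n int_mpoly ring)"

text \<open>
  Irreducible closed subsets of \<open>Spec R\<close> correspond to prime ideals, with inclusions reversed.
  The codimension of an irreducible closed subset is the supremum of the lengths of chains of
  irreducible closed subsets starting with it, that is, the height of the prime; the codimension
  of the closed subset \<open>V(I)\<close> is the infimum over the irreducible closed subsets contained in it.
  The empty closed subset has codimension \<open>\<infinity>\<close>.
\<close>

definition prime_height :: "('a, 'b) ring_scheme \<Rightarrow> 'a set \<Rightarrow> enat" where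
  "prime_height R Q =
     Sup {enat n | n. \<exists>c. (\<forall>i\<le>n. primeideal (c i) R) \<and> (\<forall>i<n. c i \<subset> c (Suc i)) \<and> c n = Q}"

definition codim :: "('a, 'b) ring_scheme \<Rightarrow> 'a set \<Rightarrow> enat" where
  "codim R I = (INF Q\<in>{Q. primeideal Q R \<and> I \<subseteq> Q}. prime_height R Q)"

definition subscheme_codim :: "'n::finite int_mpoly set \<Rightarrow> enat" where
  "subscheme_codim I = codim (ring_of_type_algebra :: 'n int_mpoly ring) I"

text \<open>
  The \<open>\<F>\<^sub>p\<close>-points of the closed subscheme, where the prime field is \<open>residue_ring p\<close>, with carrier
  \<open>{0..p - 1}\<close>: a ring homomorphism from the quotient by \<open>I\<close> to the prime field is a tuple at which
  all polynomials in \<open>I\<close> vanish modulo \<open>p\<close>.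
\<close>

definition Fp_points :: "'n::finite int_mpoly set \<Rightarrow> nat \<Rightarrow> (int ^ 'n) set" where
  "Fp_points I p =
     {y. (\<forall>i. y $ i \<in> carrier (residue_ring (int p))) \<and>
         (\<forall>f\<in>I. [eval_int_mpoly f y = 0] (mod int p))}"

definition reduce_mod :: "nat \<Rightarrow> int ^ 'n::finite \<Rightarrow> int ^ 'n" where
  "reduce_mod p x = (\<chi> i. x $ i mod int p)"

definition real_point :: "int ^ 'n::finite \<Rightarrow> real ^ 'n" where
  "real_point x = (\<chi> i. real_of_int (x $ i))"

definition sieve_set ::
  "(real ^ 'n::finite) set \<Rightarrow> 'n int_mpoly set \<Rightarrow> real \<Rightarrow> nat \<Rightarrow> int ^ 'n \<Rightarrow> real \<Rightarrow> ((int ^ 'n) \<times> nat) set"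
  where
  "sieve_set B I lam m x0 P =
     {(x, p). real_point x \<in> (\<lambda>b. lam *\<^sub>R b) ` B \<and> (\<exists>z. x = x0 + int m *s z) \<and>
              Factorial_Ring.prime p \<and> real p \<in> {P..2 * P} \<and> \<not> p dvd m \<and>
              reduce_mod p x \<in> Fp_points I p}"

end

theory Submission
  imports Defs
begin

unbundle no Formal_Power_Series.fps_syntax

text \<open>
  Write \<open>r\<close> for the number of variables and \<open>T = \<lambda>/m\<close>. The bound already holds for every prime
  separately: for a prime \<open>p \<ge> P\<close> not dividing \<open>m\<close>, the points of the box that reduce into
  \<open>\<XX>(\<F>\<^sub>p)\<close> number \<open>O(T\<^bsup>r-a\<^esup>)\<close>, and there are at most \<open>2P\<close> primes in \<open>[P, 2P]\<close>. Finally
  \<open>\<lambda>\<^bsup>\<epsilon>\<^esup> \<ge> 1\<close>, because \<open>\<lambda> > m \<ge> 1\<close>.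

  The codimension enters through elimination. If the ideal \<open>I\<close> contained no nonzero polynomial in
  some set \<open>J\<close> of more than \<open>r - a\<close> variables, there would be a prime \<open>Q \<supseteq> I\<close> with
  \<open>Q \<inter> \<int>[x\<^sub>J] = 0\<close>. Going one step down in a chain of primes ending in \<open>Q\<close> raises the number of
  algebraically independent variables by at least one, starting from \<open>|J|\<close>; so the chain has length
  at most \<open>r - |J| < a\<close>, against the assumption that \<open>Q\<close> has height at least \<open>a\<close>
  (lemmas \<open>independent_variables_extend\<close>, \<open>prime_chain_length\<close>, \<open>ideal_meets_few_variables\<close>).

  Hence with \<open>k = max 0 (r + 1 - a)\<close> there is for each \<open>J\<close> with \<open>|J| = k\<close> a nonzero \<open>g\<^sub>J \<in> I\<close> in the
  variables \<open>x\<^sub>J\<close>. These polynomials remain nonzero modulo every large prime \<open>p\<close>, and an induction on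
  the number of variables in the style of Schwartz and Zippel bounds their common zeros modulo \<open>p\<close>
  in a box with sides of size \<open>O(T)\<close> by \<open>O(T\<^bsup>k-1\<^esup>)\<close>, or by \<open>0\<close> if \<open>k = 0\<close>
  (lemma \<open>card_common_zeros_mod_prime\<close>). That a nonzero polynomial in one variable has boundedly many
  zeros on a side uses \<open>p > T\<close> and the coprimality of \<open>p\<close> and \<open>m\<close>: then a side, which is a residue
  class modulo \<open>m\<close> in an interval of length \<open>O(\<lambda>)\<close>, meets each residue class modulo \<open>p\<close> in \<open>O(1)\<close> points.

  If \<open>P\<close> is not large, then \<open>T < P\<close> is bounded as well, and the trivial bound \<open>O(T\<^sup>r)\<close> suffices.
\<close>

section \<open>Algebraic elements modulo a prime ideal\<close>

text \<open>
  The fraction field of \<open>A/(A \<inter> c)\<close> and the ring \<open>R/c\<close> localised at the image of \<open>A - c\<close> are never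
  formed: elements of \<open>A - c\<close> serve as denominators, and equations in the localised ring become
  memberships in \<open>c\<close> after clearing them. In this way algebraicity over the fraction field and
  finite-dimensional spans become statements about elements of \<open>R\<close>.
\<close>

locale prime_and_subring =
  fixes A c :: "'a::comm_ring_1 set"
  assumes sub_zero: "0 \<in> A" and sub_one: "1 \<in> A"
    and sub_add: "x \<in> A \<Longrightarrow> y \<in> A \<Longrightarrow> x + y \<in> A"
    and sub_mult: "x \<in> A \<Longrightarrow> y \<in> A \<Longrightarrow> x * y \<in> A"
    and sub_uminus: "x \<in> A \<Longrightarrow> - x \<in> A"
    and ideal_zero: "0 \<in> c"
    and ideal_add: "x \<in> c \<Longrightarrow> y \<in> c \<Longrightarrow> x + y \<in> c"
    and ideal_mult: "x \<in> c \<Longrightarrow> r * x \<in> c"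
    and proper: "1 \<notin> c"
    and prime: "x * y \<in> c \<Longrightarrow> x \<in> c \<or> y \<in> c"
begin

lemma sub_sum: "(\<And>i. i \<in> K \<Longrightarrow> f i \<in> A) \<Longrightarrow> sum f K \<in> A"
  by (induction K rule: infinite_finite_induct) (auto simp: sub_zero sub_add)

lemma ideal_mult_right: "x \<in> c \<Longrightarrow> x * r \<in> c"
  using ideal_mult[of x r] by (simp add: mult.commute)

lemma ideal_uminus: "x \<in> c \<Longrightarrow> - x \<in> c"
  using ideal_mult[of x "-1"] by simp

lemma ideal_diff: "x \<in> c \<Longrightarrow> y \<in> c \<Longrightarrow> x - y \<in> c"
  using ideal_add[of x "- y"] ideal_uminus by simp

lemma ideal_sum: "(\<And>i. i \<in> K \<Longrightarrow> f i \<in> c) \<Longrightarrow> sum f K \<in> c"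
  by (induction K rule: infinite_finite_induct) (auto simp: ideal_zero ideal_add)

text \<open>
  Gaussian elimination without division over the domain \<open>A/(A \<inter> c)\<close>, applied to more vectors than
  there are coordinates: a pivot outside \<open>c\<close> clears its coordinate from the other vectors by
  cross-multiplication, and primality keeps the resulting coefficients nontrivial.
\<close>

lemma linear_dependence_mod_prime:
  assumes "finite E" "finite K" "card K > card E"
    and "\<And>j e. j \<in> K \<Longrightarrow> e \<in> E \<Longrightarrow> v j e \<in> A"
  shows "\<exists>u. (\<forall>j\<in>K. u j \<in> A) \<and> (\<exists>j\<in>K. u j \<notin> c) \<and> (\<forall>e\<in>E. (\<Sum>j\<in>K. u j * v j e) \<in> c)"
  using assms
proof (induction E arbitrary: K v rule: finite_induct)
  case empty
  then have "K \<noteq> {}" by auto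
  with proper sub_one show ?case by (intro exI[of _ "\<lambda>_. 1"]) auto
next
  case (insert e0 E)
  show ?case
  proof (cases "\<forall>j\<in>K. v j e0 \<in> c")
    case True
    from insert.IH[of K v] insert.prems insert.hyps obtain u where u: "\<forall>j\<in>K. u j \<in> A"
      "\<exists>j\<in>K. u j \<notin> c" "\<forall>e\<in>E. (\<Sum>j\<in>K. u j * v j e) \<in> c" by auto
    have "(\<Sum>j\<in>K. u j * v j e0) \<in> c"
      using True by (intro ideal_sum ideal_mult) auto
    with u show ?thesis by auto
  next
    case False
    then obtain i where i: "i \<in> K" "v i e0 \<notin> c" by auto
    define K' where "K' = K - {i}"
    have K': "finite K'" "card K' > card E" "K = insert i K'" "i \<notin> K'"
      using insert.prems insert.hyps i by (auto simp: K'_def card_Diff_singleton)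
    define v' where "v' j e = v i e0 * v j e - v j e0 * v i e" for j e
    have "v' j e \<in> A" if "j \<in> K'" "e \<in> E" for j e
      unfolding v'_def diff_conv_add_uminus
      using that insert.prems i K' by (intro sub_add sub_uminus sub_mult) auto
    with insert.IH[of K' v'] K' obtain u where u: "\<forall>j\<in>K'. u j \<in> A"
      "\<exists>j\<in>K'. u j \<notin> c" "\<forall>e\<in>E. (\<Sum>j\<in>K'. u j * v' j e) \<in> c" by auto
    define w where "w j = (if j = i then - (\<Sum>j\<in>K'. u j * v j e0) else v i e0 * u j)" for j
    have w_sum: "(\<Sum>j\<in>K. w j * v j e) = (\<Sum>j\<in>K'. u j * v' j e)" for e
    proof -
      have "(\<Sum>j\<in>K'. w j * v j e) = (\<Sum>j\<in>K'. v i e0 * u j * v j e)"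
        using K' by (intro sum.cong) (auto simp: w_def)
      also have "\<dots> = (\<Sum>j\<in>K'. u j * v' j e) + (\<Sum>j\<in>K'. u j * v j e0) * v i e"
        unfolding v'_def sum_distrib_right sum.distrib[symmetric] by (simp add: algebra_simps)
      moreover have "w i = - (\<Sum>j\<in>K'. u j * v j e0)" by (simp add: w_def)
      ultimately show ?thesis
        using K' by simp
    qed
    have "w j \<in> A" if "j \<in> K" for j
      unfolding w_def using that u K' insert.prems
      by (auto intro!: sub_uminus sub_sum sub_mult)
    moreover have "\<exists>j\<in>K. w j \<notin> c"
    proof -
      from u(2) obtain j where j: "j \<in> K'" "u j \<notin> c" by blast
      then have "w j = v i e0 * u j" using K' by (auto simp: w_def)
      with j i prime[of "v i e0" "u j"] have "w j \<notin> c" by metis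
      with j K'(3) show ?thesis by blast
    qed
    moreover have "(\<Sum>j\<in>K'. u j * v' j e0) = 0"
      by (simp add: v'_def)
    ultimately show ?thesis
      using u(3) ideal_zero by (intro exI[of _ w]) (auto simp: w_sum)
  qed
qed

text \<open>
  Membership of \<open>r\<close> in the span of \<open>E\<close> over the fraction field of \<open>A/(A \<inter> c)\<close>, with the denominator
  \<open>s\<close> cleared.
\<close>

definition generically_spanned :: "'a set \<Rightarrow> 'a \<Rightarrow> bool" where
  "generically_spanned E r \<longleftrightarrow>
     (\<exists>s\<in>A - c. \<exists>u. (\<forall>e\<in>E. u e \<in> A) \<and> s * r - (\<Sum>e\<in>E. u e * e) \<in> c)"

definition algebraic_mod :: "'a \<Rightarrow> bool" where
  "algebraic_mod x \<longleftrightarrow>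
     (\<exists>n a. (\<forall>j\<le>n. a j \<in> A) \<and> (\<exists>j\<le>n. a j \<notin> c) \<and> (\<Sum>j\<le>n. a j * x ^ j) \<in> c)"

lemma denominator_mult: "s \<in> A - c \<Longrightarrow> t \<in> A - c \<Longrightarrow> s * t \<in> A - c"
  using sub_mult prime by auto

lemma generically_spanned_ideal: "r \<in> c \<Longrightarrow> generically_spanned E r"
  unfolding generically_spanned_def using sub_one proper sub_zero
  by (intro bexI[of _ 1] exI[of _ "\<lambda>_. 0"]) auto

lemma generically_spanned_base:
  assumes "finite E" "e \<in> E" shows "generically_spanned E e"
proof -
  have "(\<Sum>x\<in>E. (if x = e then 1 else 0) * x) = (\<Sum>x\<in>E. if x = e then x else 0)"
    by (intro sum.cong) auto
  also have "\<dots> = e" using assms by simp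
  finally show ?thesis unfolding generically_spanned_def
    using sub_one proper sub_zero ideal_zero
    by (intro bexI[of _ 1] exI[of _ "\<lambda>x. if x = e then 1 else 0"]) auto
qed

lemma generically_spanned_add:
  assumes "generically_spanned E x" "generically_spanned E y"
  shows "generically_spanned E (x + y)"
proof -
  from assms obtain s u t w where s: "s \<in> A - c" "\<forall>e\<in>E. u e \<in> A" "s * x - (\<Sum>e\<in>E. u e * e) \<in> c"
    and t: "t \<in> A - c" "\<forall>e\<in>E. w e \<in> A" "t * y - (\<Sum>e\<in>E. w e * e) \<in> c"
    unfolding generically_spanned_def by blast
  have "t * (s * x - (\<Sum>e\<in>E. u e * e)) + s * (t * y - (\<Sum>e\<in>E. w e * e)) \<in> c"
    using s t by (intro ideal_add ideal_mult)
  also have "t * (s * x - (\<Sum>e\<in>E. u e * e)) + s * (t * y - (\<Sum>e\<in>E. w e * e)) =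
      s * t * (x + y) - (\<Sum>e\<in>E. (t * u e + s * w e) * e)"
    by (simp add: algebra_simps sum.distrib sum_distrib_left)
  finally show ?thesis unfolding generically_spanned_def
    using s t denominator_mult by (intro bexI[of _ "s * t"] exI[of _ "\<lambda>e. t * u e + s * w e"])
      (auto intro!: sub_add sub_mult)
qed

lemma generically_spanned_mult:
  assumes "generically_spanned E x" "a \<in> A"
  shows "generically_spanned E (a * x)"
proof -
  from assms obtain s u where s: "s \<in> A - c" "\<forall>e\<in>E. u e \<in> A" "s * x - (\<Sum>e\<in>E. u e * e) \<in> c"
    unfolding generically_spanned_def by blast
  have "a * (s * x - (\<Sum>e\<in>E. u e * e)) \<in> c" using s by (intro ideal_mult)
  also have "a * (s * x - (\<Sum>e\<in>E. u e * e)) = s * (a * x) - (\<Sum>e\<in>E. (a * u e) * e)"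
    by (simp add: algebra_simps sum_distrib_left)
  finally show ?thesis unfolding generically_spanned_def
    using s assms by (intro bexI[of _ s] exI[of _ "\<lambda>e. a * u e"]) (auto intro!: sub_mult)
qed

lemma generically_spanned_sum:
  "(\<And>i. i \<in> K \<Longrightarrow> generically_spanned E (f i)) \<Longrightarrow> generically_spanned E (sum f K)"
  by (induction K rule: infinite_finite_induct)
    (auto simp: generically_spanned_ideal ideal_zero generically_spanned_add)

lemma generically_spanned_cancel:
  assumes "generically_spanned E (s * x)" "s \<in> A - c"
  shows "generically_spanned E x"
proof -
  from assms obtain t u where t: "t \<in> A - c" "\<forall>e\<in>E. u e \<in> A" "t * (s * x) - (\<Sum>e\<in>E. u e * e) \<in> c"
    unfolding generically_spanned_def by blast
  then show ?thesis unfolding generically_spanned_def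
    using assms(2) denominator_mult[of t s]
    by (intro bexI[of _ "t * s"] exI[of _ u]) (auto simp: mult.assoc)
qed

lemma generically_spanned_cong:
  assumes "generically_spanned E y" "x - y \<in> c"
  shows "generically_spanned E x"
  using generically_spanned_add[OF assms(1) generically_spanned_ideal[OF assms(2)]] by simp

lemma generically_spanned_trans:
  assumes "generically_spanned E x" "\<And>e. e \<in> E \<Longrightarrow> generically_spanned E' (e * y)"
  shows "generically_spanned E' (x * y)"
proof -
  from assms(1) obtain s u where s: "s \<in> A - c" "\<forall>e\<in>E. u e \<in> A" "s * x - (\<Sum>e\<in>E. u e * e) \<in> c"
    unfolding generically_spanned_def by blast
  have "generically_spanned E' (\<Sum>e\<in>E. u e * (e * y))"
  proof (rule generically_spanned_sum)
    fix e assume "e \<in> E"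
    with assms(2) s(2) show "generically_spanned E' (u e * (e * y))"
      by (intro generically_spanned_mult[of E' "e * y" "u e"]) auto
  qed
  moreover have "(s * x - (\<Sum>e\<in>E. u e * e)) * y \<in> c" using s by (intro ideal_mult_right)
  hence "s * (x * y) - (\<Sum>e\<in>E. u e * (e * y)) \<in> c"
    by (simp add: algebra_simps sum_distrib_left)
  ultimately show ?thesis
    using generically_spanned_cong generically_spanned_cancel s(1) by blast
qed

text \<open>
  Cutting an algebraic relation at its highest coefficient outside \<open>c\<close> expresses one power of \<open>x\<close>
  through the lower ones, up to a denominator.
\<close>

lemma algebraic_mod_monic:
  assumes "algebraic_mod x"
  shows "\<exists>d l a. l \<in> A - c \<and> (\<forall>j<d. a j \<in> A) \<and> l * x ^ d - (\<Sum>j<d. a j * x ^ j) \<in> c"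
proof -
  from assms obtain n a where a: "\<forall>j\<le>n. a j \<in> A" "\<exists>j\<le>n. a j \<notin> c" "(\<Sum>j\<le>n. a j * x ^ j) \<in> c"
    unfolding algebraic_mod_def by blast
  define d where "d = Max {j. j \<le> n \<and> a j \<notin> c}"
  have fin: "finite {j. j \<le> n \<and> a j \<notin> c}" by simp
  have d: "d \<le> n" "a d \<notin> c" using Max_in[OF fin] a(2) by (auto simp: d_def)
  have above: "a j \<in> c" if "j \<le> n" "j > d" for j
  proof (rule ccontr)
    assume "a j \<notin> c"
    with that(1) have "j \<le> d" unfolding d_def by (intro Max_ge fin) auto
    with that(2) show False by simp
  qed
  have "(\<Sum>j\<le>n. a j * x ^ j) = (\<Sum>j\<in>{..<d} \<union> {d} \<union> {d<..n}. a j * x ^ j)"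
    using d by (intro sum.cong) auto
  also have "\<dots> = (\<Sum>j<d. a j * x ^ j) + a d * x ^ d + (\<Sum>j\<in>{d<..n}. a j * x ^ j)"
    by (subst sum.union_disjoint; (subst sum.union_disjoint)?) auto
  finally have "(\<Sum>j\<le>n. a j * x ^ j) =
    (\<Sum>j<d. a j * x ^ j) + a d * x ^ d + (\<Sum>j\<in>{d<..n}. a j * x ^ j)" .
  moreover have "(\<Sum>j\<in>{d<..n}. a j * x ^ j) \<in> c"
    by (intro ideal_sum ideal_mult_right above) auto
  ultimately have "(\<Sum>j<d. a j * x ^ j) + a d * x ^ d \<in> c"
    using ideal_diff[OF a(3)] by (metis add_diff_cancel_right')
  then have "a d * x ^ d - (\<Sum>j<d. (- a j) * x ^ j) \<in> c"
    by (simp add: sum_negf add.commute)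
  then show ?thesis using a d
    by (intro exI[of _ d] exI[of _ "a d"] exI[of _ "\<lambda>j. - a j"]) (auto intro!: sub_uminus)
qed

text \<open>
  The relation for \<open>x\<close> reduces every power of \<open>x\<close> to powers below its degree, so the products
  \<open>e * x ^ j\<close> with \<open>e \<in> E\<close> and \<open>j\<close> below the degree can serve as \<open>E'\<close>.
\<close>

lemma generically_spanned_adjoin:
  assumes E: "finite E" and B: "\<And>b. b \<in> B \<Longrightarrow> generically_spanned E b"
    and x: "algebraic_mod x"
  shows "\<exists>E'. finite E' \<and> (\<forall>b\<in>B. \<forall>j. generically_spanned E' (b * x ^ j))"
proof -
  from algebraic_mod_monic[OF x] obtain d l a where
    l: "l \<in> A - c" and a: "\<forall>j<d. a j \<in> A" and rel: "l * x ^ d - (\<Sum>j<d. a j * x ^ j) \<in> c" by blast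
  define E' where "E' = (\<lambda>(e, j). e * x ^ j) ` (E \<times> {..<d})"
  have "finite E'" using E by (simp add: E'_def)
  have powers: "generically_spanned E' (e * x ^ j)" if e: "e \<in> E" for e j
  proof (induction j rule: less_induct)
    case (less j)
    show ?case
    proof (cases "j < d")
      case True
      with e \<open>finite E'\<close> show ?thesis by (intro generically_spanned_base) (auto simp: E'_def)
    next
      case False
      have "generically_spanned E' (\<Sum>i<d. a i * (e * x ^ (i + (j - d))))"
        using False a
        by (intro generically_spanned_sum generically_spanned_mult less.IH) auto
      moreover have "(l * x ^ d - (\<Sum>i<d. a i * x ^ i)) * (e * x ^ (j - d)) \<in> c"
        using rel by (rule ideal_mult_right)
      moreover have "(l * x ^ d - (\<Sum>i<d. a i * x ^ i)) * (e * x ^ (j - d)) =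
          l * (e * x ^ j) - (\<Sum>i<d. a i * (e * x ^ (i + (j - d))))"
      proof -
        have "x ^ j = x ^ d * x ^ (j - d)" using False by (simp flip: power_add)
        then show ?thesis
          unfolding left_diff_distrib sum_distrib_right power_add by (simp add: mult_ac)
      qed
      ultimately have "generically_spanned E' (l * (e * x ^ j))"
        by (elim generically_spanned_cong) (simp only:)
      then show ?thesis using l by (rule generically_spanned_cancel)
    qed
  qed
  show ?thesis
    using \<open>finite E'\<close> generically_spanned_trans[OF B powers] by blast
qed

text \<open>
  The powers \<open>1, f, \<dots>, f\<^bsup>|E|\<^esup>\<close> are \<open>|E| + 1\<close> vectors in a space spanned by \<open>|E|\<close> elements, so they
  are linearly dependent.
\<close>

lemma algebraic_mod_if_generically_finite:
  assumes E: "finite E" and span: "\<And>j::nat. generically_spanned E (f ^ j)"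
  shows "algebraic_mod f"
proof -
  from span have "\<forall>j. \<exists>s u. s \<in> A - c \<and> (\<forall>e\<in>E. u e \<in> A) \<and> s * f ^ j - (\<Sum>e\<in>E. u e * e) \<in> c"
    unfolding generically_spanned_def by blast
  then obtain s u where s: "\<And>j. s j \<in> A - c" and u: "\<And>j e. e \<in> E \<Longrightarrow> u j e \<in> A"
    and su: "\<And>j. s j * f ^ j - (\<Sum>e\<in>E. u j e * e) \<in> c" by metis
  from linear_dependence_mod_prime[of E "{..card E}" u] E u obtain t where
    t: "\<forall>j\<le>card E. t j \<in> A" "\<exists>j\<le>card E. t j \<notin> c"
    "\<forall>e\<in>E. (\<Sum>j\<le>card E. t j * u j e) \<in> c" by auto
  have "(\<Sum>j\<le>card E. t j * (s j * f ^ j - (\<Sum>e\<in>E. u j e * e))) +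
      (\<Sum>e\<in>E. (\<Sum>j\<le>card E. t j * u j e) * e) \<in> c"
  proof (rule ideal_add)
    show "(\<Sum>j\<le>card E. t j * (s j * f ^ j - (\<Sum>e\<in>E. u j e * e))) \<in> c"
      by (rule ideal_sum, rule ideal_mult, rule su)
    show "(\<Sum>e\<in>E. (\<Sum>j\<le>card E. t j * u j e) * e) \<in> c"
      by (rule ideal_sum, rule ideal_mult_right) (use t(3) in blast)
  qed
  also have "(\<Sum>e\<in>E. (\<Sum>j\<le>card E. t j * u j e) * e) =
      (\<Sum>j\<le>card E. t j * (\<Sum>e\<in>E. u j e * e))"
    unfolding sum_distrib_left sum_distrib_right by (subst sum.swap) (simp add: mult.assoc)
  finally have "(\<Sum>j\<le>card E. (t j * s j) * f ^ j) \<in> c"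
    by (simp add: right_diff_distrib sum_subtractf mult.assoc)
  moreover have "\<exists>j\<le>card E. t j * s j \<notin> c" using t(2) s prime by blast
  moreover have "\<forall>j\<le>card E. t j * s j \<in> A" using t s sub_mult by blast
  ultimately show ?thesis unfolding algebraic_mod_def
    by (intro exI[of _ "card E"] exI[of _ "\<lambda>j. t j * s j"]) blast
qed

text \<open>
  In a relation \<open>\<Sum> a\<^sub>j f\<^sup>j \<in> c\<close> take the lowest coefficient \<open>a\<^sub>m\<close> outside \<open>c\<close>. As \<open>c\<close> is prime and
  \<open>f \<notin> c\<close>, the power \<open>f\<^sup>m\<close> cancels, which leaves \<open>a\<^sub>m + f g \<in> c \<subseteq> c'\<close>; since \<open>f \<in> c'\<close>, also
  \<open>a\<^sub>m \<in> c'\<close>.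
\<close>

lemma algebraic_element_of_larger_ideal:
  assumes alg: "algebraic_mod f" and f: "f \<in> c'" "f \<notin> c" and sub: "c \<subseteq> c'"
    and add': "\<And>x y. x \<in> c' \<Longrightarrow> y \<in> c' \<Longrightarrow> x + y \<in> c'"
    and mult': "\<And>x r. x \<in> c' \<Longrightarrow> r * x \<in> c'"
  shows "\<exists>a\<in>A. a \<in> c' \<and> a \<notin> c"
proof -
  from alg obtain n a where a: "\<forall>j\<le>n. a j \<in> A" "\<exists>j\<le>n. a j \<notin> c" "(\<Sum>j\<le>n. a j * f ^ j) \<in> c"
    unfolding algebraic_mod_def by blast
  define m where "m = (LEAST j. j \<le> n \<and> a j \<notin> c)"
  have m: "m \<le> n" "a m \<notin> c"
    using LeastI_ex[of "\<lambda>j. j \<le> n \<and> a j \<notin> c"] a(2) by (auto simp: m_def)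
  have below: "a j \<in> c" if "j < m" for j
    using not_less_Least[of j "\<lambda>j. j \<le> n \<and> a j \<notin> c"] that m by (auto simp: m_def)
  define g where "g = (\<Sum>j\<in>{m<..n}. a j * f ^ (j - Suc m))"
  have "(\<Sum>j\<le>n. a j * f ^ j) = (\<Sum>j\<in>{..<m} \<union> {m} \<union> {m<..n}. a j * f ^ j)"
    using m by (intro sum.cong) auto
  also have "\<dots> = (\<Sum>j<m. a j * f ^ j) + a m * f ^ m + (\<Sum>j\<in>{m<..n}. a j * f ^ j)"
    by (subst sum.union_disjoint; (subst sum.union_disjoint)?) auto
  also have "(\<Sum>j\<in>{m<..n}. a j * f ^ j) = f ^ m * (f * g)"
    unfolding g_def sum_distrib_left
  proof (intro sum.cong)
    fix j assume "j \<in> {m<..n}"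
    then have "f ^ j = f ^ (m + Suc (j - Suc m))" by simp
    also have "\<dots> = f ^ m * (f * f ^ (j - Suc m))" unfolding power_add power_Suc ..
    finally show "a j * f ^ j = f ^ m * (f * (a j * f ^ (j - Suc m)))" by (simp add: mult_ac)
  qed simp
  finally have split: "(\<Sum>j\<le>n. a j * f ^ j) =
      (\<Sum>j<m. a j * f ^ j) + f ^ m * (a m + f * g)" by (simp add: algebra_simps)
  have "(\<Sum>j<m. a j * f ^ j) \<in> c" using below by (intro ideal_sum ideal_mult_right) auto
  with a(3) split have "f ^ m * (a m + f * g) \<in> c" using ideal_diff by fastforce
  moreover have "f ^ m \<notin> c" by (induction m) (use proper prime f in auto)
  ultimately have "a m + f * g \<in> c'" using prime sub by blast
  moreover have "(- g) * f \<in> c'" using f(1) by (rule mult')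
  ultimately have "(a m + f * g) + (- g) * f \<in> c'" by (rule add')
  then have "a m \<in> c'" by (simp add: algebra_simps)
  with a m show ?thesis by blast
qed

end

section \<open>Integer polynomials in finitely many variables\<close>

definition polys_in :: "'n set \<Rightarrow> 'n::finite int_mpoly set" where
  "polys_in M = {f. \<forall>k\<in>Poly_Mapping.keys f. Poly_Mapping.keys k \<subseteq> M}"

definition Var :: "'n \<Rightarrow> 'n::finite int_mpoly" where
  "Var i = Poly_Mapping.single (Poly_Mapping.single i 1) 1"

text \<open>
  The coefficient of \<open>x\<^sub>i\<^sup>j\<close> when \<open>f\<close> is regarded as a polynomial in \<open>x\<^sub>i\<close>; it no longer involves
  \<open>x\<^sub>i\<close>.
\<close>

definition coeff_in :: "'n \<Rightarrow> nat \<Rightarrow> 'n::finite int_mpoly \<Rightarrow> 'n int_mpoly" where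
  "coeff_in i j f =
     (\<Sum>k\<in>{k\<in>Poly_Mapping.keys f. Poly_Mapping.lookup k i = j}.
        Poly_Mapping.single (k - Poly_Mapping.single i j) (Poly_Mapping.lookup f k))"

definition max_degree_le :: "nat \<Rightarrow> 'n::finite int_mpoly \<Rightarrow> bool" where
  "max_degree_le D f \<longleftrightarrow> (\<forall>k\<in>Poly_Mapping.keys f. \<forall>i. Poly_Mapping.lookup k i \<le> D)"

lemma ex_max_degree_le: "\<exists>D. max_degree_le D f"
proof -
  have "max_degree_le (Max ((\<lambda>(k, i). Poly_Mapping.lookup k i) ` (Poly_Mapping.keys f \<times> UNIV))) f"
    unfolding max_degree_le_def by (auto intro!: Max_ge)
  then show ?thesis ..
qed

lemma max_degree_le_mono: "max_degree_le D f \<Longrightarrow> D \<le> D' \<Longrightarrow> max_degree_le D' f"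
  unfolding max_degree_le_def by (meson order_trans)

lemma mpoly_monomials:
  fixes f :: "('n::finite) int_mpoly"
  shows "f = (\<Sum>k\<in>Poly_Mapping.keys f. Poly_Mapping.single k (Poly_Mapping.lookup f k))"
proof (rule poly_mapping_eqI)
  fix k
  have "Poly_Mapping.lookup (\<Sum>k\<in>Poly_Mapping.keys f. Poly_Mapping.single k (Poly_Mapping.lookup f k)) k
      = (\<Sum>l\<in>Poly_Mapping.keys f. if l = k then Poly_Mapping.lookup f k else 0)"
    unfolding lookup_sum by (intro sum.cong) (auto simp: lookup_single when_def)
  also have "\<dots> = Poly_Mapping.lookup f k" by (simp add: in_keys_iff)
  finally show "Poly_Mapping.lookup f k =
    Poly_Mapping.lookup (\<Sum>k\<in>Poly_Mapping.keys f. Poly_Mapping.single k (Poly_Mapping.lookup f k)) k" ..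
qed

lemma polys_in_UNIV [simp]: "polys_in UNIV = UNIV"
  by (auto simp: polys_in_def)

lemma polys_in_zero: "0 \<in> polys_in M" and polys_in_one: "1 \<in> polys_in M"
  by (auto simp: polys_in_def)

lemma polys_in_uminus: "f \<in> polys_in M \<Longrightarrow> - f \<in> polys_in M"
  by (auto simp: polys_in_def)

lemma polys_in_add: "f \<in> polys_in M \<Longrightarrow> g \<in> polys_in M \<Longrightarrow> f + g \<in> polys_in M"
  using Poly_Mapping.keys_add[of f g] by (fastforce simp: polys_in_def)

lemma polys_in_sum: "(\<And>i. i \<in> K \<Longrightarrow> f i \<in> polys_in M) \<Longrightarrow> sum f K \<in> polys_in M"
  by (induction K rule: infinite_finite_induct) (auto simp: polys_in_zero polys_in_add)

lemma polys_in_mult: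
  assumes "f \<in> polys_in M" "g \<in> polys_in M" shows "f * g \<in> polys_in M"
  unfolding polys_in_def
proof safe
  fix k i assume k: "k \<in> Poly_Mapping.keys (f * g)" and i: "i \<in> Poly_Mapping.keys k"
  from k Poly_Mapping.keys_mult[of f g] obtain a b where
    "k = a + b" "a \<in> Poly_Mapping.keys f" "b \<in> Poly_Mapping.keys g" by blast
  with i assms show "i \<in> M"
    using Poly_Mapping.keys_add[of a b] unfolding polys_in_def by blast
qed

lemma coeff_in_polys_in:
  assumes "f \<in> polys_in (insert i M)" shows "coeff_in i j f \<in> polys_in M"
  unfolding coeff_in_def
proof (rule polys_in_sum)
  fix k assume k: "k \<in> {k \<in> Poly_Mapping.keys f. Poly_Mapping.lookup k i = j}"
  have "Poly_Mapping.keys (k - Poly_Mapping.single i j) \<subseteq> M"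
  proof
    fix l assume "l \<in> Poly_Mapping.keys (k - Poly_Mapping.single i j)"
    then have "l \<noteq> i" "l \<in> Poly_Mapping.keys k" using k
      by (auto simp: in_keys_iff lookup_minus lookup_single when_def split: if_splits)
    with assms k show "l \<in> M" unfolding polys_in_def by blast
  qed
  then show "Poly_Mapping.single (k - Poly_Mapping.single i j) (Poly_Mapping.lookup f k) \<in> polys_in M"
    by (simp add: polys_in_def)
qed

lemma lookup_coeff_in:
  assumes "Poly_Mapping.lookup k i = j" "k \<in> Poly_Mapping.keys f"
  shows "Poly_Mapping.lookup (coeff_in i j f) (k - Poly_Mapping.single i j) = Poly_Mapping.lookup f k"
proof -
  have split: "l = (l - Poly_Mapping.single i j) + Poly_Mapping.single i j"
    if "Poly_Mapping.lookup l i = j" for l :: "'a \<Rightarrow>\<^sub>0 nat"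
    using that by (intro poly_mapping_eqI) (auto simp: lookup_add lookup_minus lookup_single when_def)
  have "Poly_Mapping.lookup (coeff_in i j f) (k - Poly_Mapping.single i j) =
     (\<Sum>l\<in>{l\<in>Poly_Mapping.keys f. Poly_Mapping.lookup l i = j}.
        if l = k then Poly_Mapping.lookup f k else 0)"
    unfolding coeff_in_def lookup_sum
    using split assms(1) by (intro sum.cong) (auto simp: lookup_single when_def, metis)
  also have "\<dots> = Poly_Mapping.lookup f k" using assms by simp
  finally show ?thesis .
qed

lemma max_degree_le_coeff_in:
  assumes "max_degree_le D f" shows "max_degree_le D (coeff_in i j f)"
  unfolding max_degree_le_def
proof safe
  fix k l assume "k \<in> Poly_Mapping.keys (coeff_in i j f)"
  then obtain k' where k': "k' \<in> Poly_Mapping.keys f" "k = k' - Poly_Mapping.single i j"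
    unfolding coeff_in_def using Poly_Mapping.keys_sum[of _ "{k \<in> Poly_Mapping.keys f. Poly_Mapping.lookup k i = j}"]
    by (fastforce split: if_splits)
  then have "Poly_Mapping.lookup k l \<le> Poly_Mapping.lookup k' l" by (simp add: lookup_minus)
  with k' assms show "Poly_Mapping.lookup k l \<le> D"
    unfolding max_degree_le_def by (meson order_trans)
qed

lemma Var_power: "Var i ^ j = Poly_Mapping.single (Poly_Mapping.single i j) 1"
  by (induction j) (auto simp: Var_def mult_single single_add[symmetric])

lemma mpoly_expand:
  fixes f :: "('n::finite) int_mpoly"
  assumes "max_degree_le D f"
  shows "f = (\<Sum>j\<le>D. coeff_in i j f * Var i ^ j)"
proof -
  have "coeff_in i j f * Var i ^ j =
      (\<Sum>k\<in>{k\<in>Poly_Mapping.keys f. Poly_Mapping.lookup k i = j}.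
        Poly_Mapping.single k (Poly_Mapping.lookup f k))" for j
    unfolding coeff_in_def Var_power sum_distrib_right mult_single
  proof (intro sum.cong)
    fix k assume k: "k \<in> {k\<in>Poly_Mapping.keys f. Poly_Mapping.lookup k i = j}"
    then have "k - Poly_Mapping.single i j + Poly_Mapping.single i j = k"
      by (intro poly_mapping_eqI) (auto simp: lookup_add lookup_minus lookup_single when_def)
    then show "Poly_Mapping.single (k - Poly_Mapping.single i j + Poly_Mapping.single i j)
          (Poly_Mapping.lookup f k * 1) = Poly_Mapping.single k (Poly_Mapping.lookup f k)"
      by simp
  qed simp
  then have "(\<Sum>j\<le>D. coeff_in i j f * Var i ^ j) =
     (\<Sum>j\<le>D. \<Sum>k\<in>{k\<in>Poly_Mapping.keys f. Poly_Mapping.lookup k i = j}.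
        Poly_Mapping.single k (Poly_Mapping.lookup f k))" by simp
  also have "\<dots> = (\<Sum>k\<in>Poly_Mapping.keys f. Poly_Mapping.single k (Poly_Mapping.lookup f k))"
    using assms by (intro sum.group) (auto simp: max_degree_le_def)
  finally show ?thesis using mpoly_monomials[of f] by simp
qed

lemma eval_int_mpoly_superset:
  assumes "finite K" "Poly_Mapping.keys f \<subseteq> K"
  shows "eval_int_mpoly f x =
    (\<Sum>k\<in>K. Poly_Mapping.lookup f k * (\<Prod>i\<in>UNIV. (x $ i) ^ Poly_Mapping.lookup k i))"
  unfolding eval_int_mpoly_def using assms
  by (intro sum.mono_neutral_left) (auto simp: in_keys_iff)

lemma eval_int_mpoly_add: "eval_int_mpoly (f + g) x = eval_int_mpoly f x + eval_int_mpoly g x"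
proof -
  let ?K = "Poly_Mapping.keys f \<union> Poly_Mapping.keys g"
  show ?thesis
    using Poly_Mapping.keys_add[of f g]
    by (subst (1 2 3) eval_int_mpoly_superset[of ?K])
      (auto simp: lookup_add distrib_right sum.distrib)
qed

lemma eval_int_mpoly_zero: "eval_int_mpoly 0 x = 0"
  by (simp add: eval_int_mpoly_def)

lemma eval_int_mpoly_sum: "eval_int_mpoly (sum f K) x = (\<Sum>i\<in>K. eval_int_mpoly (f i) x)"
  by (induction K rule: infinite_finite_induct) (auto simp: eval_int_mpoly_zero eval_int_mpoly_add)

lemma eval_int_mpoly_single:
  "eval_int_mpoly (Poly_Mapping.single k a) x = a * (\<Prod>i\<in>UNIV. (x $ i) ^ Poly_Mapping.lookup k i)"
  by (subst eval_int_mpoly_superset[of "{k}"]) auto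

lemma eval_int_mpoly_mult: "eval_int_mpoly (f * g) x = eval_int_mpoly f x * eval_int_mpoly g x"
proof -
  have single: "eval_int_mpoly (Poly_Mapping.single k a * Poly_Mapping.single l b) x =
      eval_int_mpoly (Poly_Mapping.single k a) x * eval_int_mpoly (Poly_Mapping.single l b) x" for k l a b
    by (simp add: mult_single eval_int_mpoly_single lookup_add power_add prod.distrib mult_ac)
  show ?thesis
    by (subst (1 2) mpoly_monomials[of f], subst (1 2) mpoly_monomials[of g])
      (simp only: sum_product eval_int_mpoly_sum single)
qed

lemma eval_int_mpoly_Var_power: "eval_int_mpoly (Var i ^ j) x = (x $ i) ^ j"
proof -
  have "(\<Prod>l\<in>UNIV. (x $ l) ^ Poly_Mapping.lookup (Poly_Mapping.single i j) l) =
      (\<Prod>l\<in>UNIV. if l = i then (x $ i) ^ j else 1)"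
    by (intro prod.cong) (auto simp: lookup_single when_def)
  then show ?thesis by (simp add: Var_power eval_int_mpoly_single)
qed

lemma eval_int_mpoly_expand:
  assumes "max_degree_le D f"
  shows "eval_int_mpoly f x = (\<Sum>j\<le>D. eval_int_mpoly (coeff_in i j f) x * (x $ i) ^ j)"
  by (subst mpoly_expand[OF assms, of i])
    (simp add: eval_int_mpoly_sum eval_int_mpoly_mult eval_int_mpoly_Var_power)

lemma eval_int_mpoly_cong:
  assumes "f \<in> polys_in M" "\<And>i. i \<in> M \<Longrightarrow> x $ i = y $ i"
  shows "eval_int_mpoly f x = eval_int_mpoly f y"
  unfolding eval_int_mpoly_def
proof (intro sum.cong refl arg_cong2[of _ _ _ _ "(*)"] prod.cong)
  fix k i assume "k \<in> Poly_Mapping.keys f"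
  then have "Poly_Mapping.keys k \<subseteq> M" using assms(1) by (simp add: polys_in_def)
  then have "i \<notin> M \<Longrightarrow> Poly_Mapping.lookup k i = 0" by (auto simp: in_keys_iff)
  then show "(x $ i) ^ Poly_Mapping.lookup k i = (y $ i) ^ Poly_Mapping.lookup k i"
    using assms(2) by (cases "i \<in> M") auto
qed

lemma eval_int_mpoly_update:
  assumes f: "f \<in> polys_in (insert i M)" "max_degree_le D f" and "i \<notin> M"
  shows "eval_int_mpoly f (\<chi> l. if l = i then t else y $ l) =
    (\<Sum>j\<le>D. eval_int_mpoly (coeff_in i j f) y * t ^ j)"
proof -
  let ?x = "\<chi> l. if l = i then t else y $ l"
  have "eval_int_mpoly (coeff_in i j f) ?x = eval_int_mpoly (coeff_in i j f) y" for j
    using coeff_in_polys_in[OF f(1)] \<open>i \<notin> M\<close> by (intro eval_int_mpoly_cong[of _ M]) auto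
  then show ?thesis using eval_int_mpoly_expand[OF f(2), of ?x i] by simp
qed

lemma polys_in_empty:
  assumes "f \<in> polys_in {}"
  shows "k \<noteq> 0 \<Longrightarrow> Poly_Mapping.lookup f k = 0" "eval_int_mpoly f x = Poly_Mapping.lookup f 0"
proof -
  have keys: "Poly_Mapping.keys f \<subseteq> {0}" using assms by (auto simp: polys_in_def)
  then show "k \<noteq> 0 \<Longrightarrow> Poly_Mapping.lookup f k = 0" by (auto simp: in_keys_iff)
  show "eval_int_mpoly f x = Poly_Mapping.lookup f 0"
    using keys by (subst eval_int_mpoly_superset[of "{0}"]) auto
qed

lemma finite_int_roots:
  fixes a :: "nat \<Rightarrow> int"
  assumes "\<exists>j\<le>n. a j \<noteq> 0"
  shows "finite {t. (\<Sum>j\<le>n. a j * t ^ j) = 0}"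
proof -
  have "finite {z::real. (\<Sum>j\<le>n. real_of_int (a j) * z ^ j) = 0}"
    unfolding polyfun_finite_roots using assms by simp
  moreover have "real_of_int ` {t. (\<Sum>j\<le>n. a j * t ^ j) = 0} \<subseteq>
      {z::real. (\<Sum>j\<le>n. real_of_int (a j) * z ^ j) = 0}"
  proof safe
    fix t assume "(\<Sum>j\<le>n. a j * t ^ j) = 0"
    then have "real_of_int (\<Sum>j\<le>n. a j * t ^ j) = 0" by simp
    then show "(\<Sum>j\<le>n. real_of_int (a j) * real_of_int t ^ j) = 0" by simp
  qed
  ultimately show ?thesis
    by (meson finite_imageD finite_subset inj_onI of_int_eq_iff)
qed

lemma coeff_in_nonzero:
  assumes "f \<noteq> 0" "max_degree_le D f" shows "\<exists>j\<le>D. coeff_in i j f \<noteq> 0"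
  using mpoly_expand[OF assms(2), of i] assms(1)
  by (metis (no_types, lifting) atMost_iff mult_zero_left sum.neutral)

text \<open>
  Over the infinite domain of integers, nonzero polynomials are nonzero functions. Two polynomials
  are treated at once because a common point of nonvanishing shows that their product is nonzero.
\<close>

lemma common_nonvanishing_point:
  assumes "f \<in> polys_in M" "g \<in> polys_in M" "f \<noteq> 0" "g \<noteq> 0"
  shows "\<exists>x. eval_int_mpoly f x \<noteq> 0 \<and> eval_int_mpoly g x \<noteq> 0"
proof -
  have "finite M" by simp
  then show ?thesis using assms
  proof (induction M arbitrary: f g rule: finite_induct)
    case empty
    then have "Poly_Mapping.lookup f 0 \<noteq> 0" "Poly_Mapping.lookup g 0 \<noteq> 0"
      by (metis polys_in_empty(1) poly_mapping_eqI lookup_zero)+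
    with empty show ?case by (auto simp: polys_in_empty(2))
  next
    case (insert i M)
    obtain D1 D2 where "max_degree_le D1 f" "max_degree_le D2 g"
      using ex_max_degree_le by blast
    then have D: "max_degree_le (max D1 D2) f" "max_degree_le (max D1 D2) g"
      by (auto elim: max_degree_le_mono)
    define D where "D = max D1 D2"
    obtain j l where j: "j \<le> D" "coeff_in i j f \<noteq> 0" and l: "l \<le> D" "coeff_in i l g \<noteq> 0"
      using coeff_in_nonzero[OF _ D(1)] coeff_in_nonzero[OF _ D(2)] insert.prems
      unfolding D_def by metis
    obtain y where y: "eval_int_mpoly (coeff_in i j f) y \<noteq> 0" "eval_int_mpoly (coeff_in i l g) y \<noteq> 0"
      using insert.IH[of "coeff_in i j f" "coeff_in i l g"] j l insert.prems coeff_in_polys_in by blast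
    define F where "F h = {t. (\<Sum>j\<le>D. eval_int_mpoly (coeff_in i j h) y * t ^ j) = 0}" for h
    have "finite (F f \<union> F g)"
      unfolding F_def using y j l by (intro finite_UnI finite_int_roots) auto
    then obtain t where t: "t \<notin> F f \<union> F g" using ex_new_if_finite[OF infinite_UNIV_int] by blast
    then show ?case
      using eval_int_mpoly_update[OF insert.prems(1) D(1) insert.hyps(2), of t y]
        eval_int_mpoly_update[OF insert.prems(2) D(2) insert.hyps(2), of t y]
      unfolding F_def D_def by (intro exI[of _ "\<chi> l. if l = i then t else y $ l"]) simp
  qed
qed

lemma mpoly_no_zero_divisors:
  fixes f g :: "('n::finite) int_mpoly"
  assumes "f \<noteq> 0" "g \<noteq> 0" shows "f * g \<noteq> 0"
proof
  assume "f * g = 0"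
  obtain x where "eval_int_mpoly f x \<noteq> 0" "eval_int_mpoly g x \<noteq> 0"
    using common_nonvanishing_point[of f UNIV g] assms by auto
  with \<open>f * g = 0\<close> show False
    using eval_int_mpoly_mult[of f g x] by (simp add: eval_int_mpoly_zero)
qed

section \<open>Heights of primes and elimination of variables\<close>

lemma ideal_ring_of_type_algebraD:
  fixes I :: "'a::comm_ring_1 set"
  assumes "ideal I (ring_of_type_algebra :: 'a ring)"
  shows "0 \<in> I" "x \<in> I \<Longrightarrow> y \<in> I \<Longrightarrow> x + y \<in> I" "x \<in> I \<Longrightarrow> r * x \<in> I"
proof -
  interpret ideal I "ring_of_type_algebra :: 'a ring" by fact
  show "0 \<in> I"
    using additive_subgroup.zero_closed[OF additive_subgroup_axioms]
    by (simp add: ring_of_type_algebra_def)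
  show "x \<in> I \<Longrightarrow> y \<in> I \<Longrightarrow> x + y \<in> I"
    using additive_subgroup.a_closed[OF additive_subgroup_axioms, of x y] by (simp add: ring_of_type_algebra_def)
  show "x \<in> I \<Longrightarrow> r * x \<in> I"
    using I_l_closed[of x r] by (simp add: ring_of_type_algebra_def)
qed

lemma primeideal_ring_of_type_algebraI:
  fixes Q :: "'a::comm_ring_1 set"
  assumes "0 \<in> Q" "\<And>x y. x \<in> Q \<Longrightarrow> y \<in> Q \<Longrightarrow> x + y \<in> Q" and mult: "\<And>x r. x \<in> Q \<Longrightarrow> r * x \<in> Q"
    and "1 \<notin> Q" "\<And>x y. x * y \<in> Q \<Longrightarrow> x \<in> Q \<or> y \<in> Q"
  shows "primeideal Q (ring_of_type_algebra :: 'a ring)"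
proof (rule primeidealI2)
  let ?R = "ring_of_type_algebra :: 'a ring"
  show R: "cring ?R" by (rule cring_from_type_algebra)
  interpret cring ?R by (rule R)
  show "additive_subgroup Q ?R"
  proof
    show "Q \<subseteq> carrier (add_monoid ?R)" by (simp add: ring_of_type_algebra_def)
    show "x \<otimes>\<^bsub>add_monoid ?R\<^esub> y \<in> Q" if "x \<in> Q" "y \<in> Q" for x y
      using assms that by (simp add: ring_of_type_algebra_def)
    show "\<one>\<^bsub>add_monoid ?R\<^esub> \<in> Q" using assms by (simp add: ring_of_type_algebra_def)
    show "inv\<^bsub>add_monoid ?R\<^esub> x \<in> Q" if "x \<in> Q" for x
    proof -
      have "\<ominus>\<^bsub>?R\<^esub> x = - x"
        by (rule minus_equality) (auto simp: ring_of_type_algebra_def)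
      then show ?thesis using mult[OF that, of "-1"] by (simp add: a_inv_def)
    qed
  qed
  have "1 \<in> carrier ?R" by (simp add: ring_of_type_algebra_def)
  with assms(4) show "carrier ?R \<noteq> Q" by blast
qed (use assms in \<open>auto simp: ring_of_type_algebra_def mult.commute\<close>)

lemma primeideal_ring_of_type_algebraD:
  fixes Q :: "'a::comm_ring_1 set"
  assumes "primeideal Q (ring_of_type_algebra :: 'a ring)"
  shows "1 \<notin> Q" "x * y \<in> Q \<Longrightarrow> x \<in> Q \<or> y \<in> Q"
proof -
  interpret primeideal Q "ring_of_type_algebra :: 'a ring" by fact
  show "x * y \<in> Q \<Longrightarrow> x \<in> Q \<or> y \<in> Q"
    using I_prime[of x y] by (simp add: ring_of_type_algebra_def)
  show "1 \<notin> Q"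
    using I_notcarr one_imp_carrier by (auto simp: ring_of_type_algebra_def)
qed

text \<open>
  An ideal that is maximal among those containing \<open>I\<close> and disjoint from \<open>S\<close> is prime.
\<close>

lemma ex_primeideal_avoiding:
  fixes I S :: "'a::comm_ring_1 set"
  assumes I: "ideal I (ring_of_type_algebra :: 'a ring)"
    and S: "1 \<in> S" "\<And>s t. s \<in> S \<Longrightarrow> t \<in> S \<Longrightarrow> s * t \<in> S" and "I \<inter> S = {}"
  shows "\<exists>Q. primeideal Q (ring_of_type_algebra :: 'a ring) \<and> I \<subseteq> Q \<and> Q \<inter> S = {}"
proof -
  define is_ideal where "is_ideal J \<longleftrightarrow> 0 \<in> J \<and> (\<forall>x\<in>J. \<forall>y\<in>J. x + y \<in> J) \<and> (\<forall>x\<in>J. \<forall>r. r * x \<in> J)"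
    for J :: "'a set"
  define \<A> where "\<A> = {J. is_ideal J \<and> I \<subseteq> J \<and> J \<inter> S = {}}"
  have "I \<in> \<A>"
    using assms ideal_ring_of_type_algebraD[OF I] by (auto simp: \<A>_def is_ideal_def)
  moreover have "\<Union>\<C> \<in> \<A>" if "\<C> \<noteq> {}" and chain: "subset.chain \<A> \<C>" for \<C>
  proof -
    from chain have "\<C> \<subseteq> \<A>" and lin: "\<And>J K. J \<in> \<C> \<Longrightarrow> K \<in> \<C> \<Longrightarrow> J \<subseteq> K \<or> K \<subseteq> J"
      by (simp_all add: subset_chain_def)
    then have add: "\<And>x y J. J \<in> \<C> \<Longrightarrow> x \<in> J \<Longrightarrow> y \<in> J \<Longrightarrow> x + y \<in> J"
      and mult: "\<And>r x J. J \<in> \<C> \<Longrightarrow> x \<in> J \<Longrightarrow> r * x \<in> J"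
      and other: "\<And>J. J \<in> \<C> \<Longrightarrow> 0 \<in> J \<and> I \<subseteq> J \<and> J \<inter> S = {}"
      unfolding \<A>_def is_ideal_def by blast+
    obtain J0 where J0: "J0 \<in> \<C>" using \<open>\<C> \<noteq> {}\<close> by blast
    have "x + y \<in> \<Union>\<C>" if xy: "x \<in> \<Union>\<C>" "y \<in> \<Union>\<C>" for x y
    proof -
      from xy obtain J K where JK: "J \<in> \<C>" "K \<in> \<C>" "x \<in> J" "y \<in> K" by blast
      with lin[of J K] consider "x \<in> K" | "y \<in> J" by blast
      then show ?thesis using JK add by cases blast+
    qed
    moreover have "r * x \<in> \<Union>\<C>" if "x \<in> \<Union>\<C>" for r x using that mult by blast
    moreover have "0 \<in> \<Union>\<C>" "I \<subseteq> \<Union>\<C>" using J0 other[OF J0] by auto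
    moreover have "\<Union>\<C> \<inter> S = {}" using other by fast
    ultimately show ?thesis by (simp add: \<A>_def is_ideal_def)
  qed
  ultimately obtain Q where Q: "Q \<in> \<A>" and max: "\<And>J. J \<in> \<A> \<Longrightarrow> Q \<subseteq> J \<Longrightarrow> J = Q"
    using subset_Zorn_nonempty[of \<A>] by blast
  from Q have QI: "0 \<in> Q" "\<And>x y. x \<in> Q \<Longrightarrow> y \<in> Q \<Longrightarrow> x + y \<in> Q" "\<And>x r. x \<in> Q \<Longrightarrow> r * x \<in> Q"
    and sub: "I \<subseteq> Q" "Q \<inter> S = {}" by (auto simp: \<A>_def is_ideal_def)
  have meets: "\<exists>q\<in>Q. \<exists>r. q + r * x \<in> S" if "x \<notin> Q" for x
  proof (rule ccontr)
    assume none: "\<not> ?thesis"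
    let ?J = "{q + r * x | q r. q \<in> Q}"
    have J_I: "q + r * x \<in> ?J" if "q \<in> Q" for q r using that by blast
    have "is_ideal ?J" unfolding is_ideal_def
    proof (intro conjI ballI allI)
      show "0 \<in> ?J" using J_I[OF QI(1), of 0] by simp
      show "y + z \<in> ?J" if y: "y \<in> ?J" and z: "z \<in> ?J" for y z
      proof -
        from y obtain q r where q: "y = q + r * x" "q \<in> Q" by blast
        from z obtain q' r' where q': "z = q' + r' * x" "q' \<in> Q" by blast
        have "y + z = (q + q') + (r + r') * x" using q q' by (simp add: algebra_simps)
        with J_I[OF QI(2)[OF q(2) q'(2)], of "r + r'"] show ?thesis by (simp only:)
      qed
      show "t * y \<in> ?J" if y: "y \<in> ?J" for y t
      proof -
        from y obtain q r where q: "y = q + r * x" "q \<in> Q" by blast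
        have "t * y = t * q + (t * r) * x" using q by (simp add: algebra_simps)
        with J_I[OF QI(3)[OF q(2)], of t "t * r"] show ?thesis by (simp only:)
      qed
    qed
    moreover have "Q \<subseteq> ?J" using J_I[of _ 0] by auto
    moreover have "x \<in> ?J" using J_I[OF QI(1), of 1] by simp
    ultimately have "?J = Q" using none sub by (intro max) (auto simp: \<A>_def)
    with \<open>x \<in> ?J\<close> \<open>x \<notin> Q\<close> show False by blast
  qed
  have "x \<in> Q \<or> y \<in> Q" if xy: "x * y \<in> Q" for x y
  proof (rule ccontr)
    assume "\<not> ?thesis"
    then obtain q r q' r' where q: "q \<in> Q" "q + r * x \<in> S" and q': "q' \<in> Q" "q' + r' * y \<in> S"
      using meets by meson
    have "(q + r * x) * (q' + r' * y) = (q' + r' * y) * q + (r * x) * q' + (r * r') * (x * y)"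
      by (simp add: algebra_simps)
    also have "\<dots> \<in> Q"
      by (rule QI(2)[OF QI(2)[OF QI(3)[OF q(1)] QI(3)[OF q'(1)]] QI(3)[OF xy]])
    finally show False using S(2)[OF q(2) q'(2)] sub by blast
  qed
  moreover have "1 \<notin> Q" using S sub by blast
  ultimately have "primeideal Q (ring_of_type_algebra :: 'a ring)"
    using QI by (intro primeideal_ring_of_type_algebraI) auto
  with sub show ?thesis by blast
qed

lemma prime_and_subring_polys_in:
  fixes c :: "('n::finite) int_mpoly set"
  assumes "primeideal c (ring_of_type_algebra :: 'n int_mpoly ring)"
  shows "prime_and_subring (polys_in M) c"
proof -
  have "ideal c (ring_of_type_algebra :: 'n int_mpoly ring)"
    using assms by (rule primeideal.axioms(1))
  note c = ideal_ring_of_type_algebraD[OF this] primeideal_ring_of_type_algebraD[OF assms]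
  show ?thesis
    by unfold_locales
      (fact polys_in_zero polys_in_one polys_in_add polys_in_mult polys_in_uminus c)+
qed

text \<open>
  Suppose that no variable could be added to \<open>M\<close>. Then every variable, and hence every polynomial,
  is algebraic over \<open>\<int>[x\<^sub>M]\<close> modulo \<open>c\<close>. An element of \<open>c' - c\<close> then produces an element of
  \<open>\<int>[x\<^sub>M]\<close> in \<open>c' - c\<close>, although \<open>c'\<close> meets \<open>\<int>[x\<^sub>M]\<close> only in \<open>0\<close>.
\<close>

lemma independent_variables_extend:
  fixes c c' :: "('n::finite) int_mpoly set"
  assumes c: "primeideal c (ring_of_type_algebra :: 'n int_mpoly ring)"
    and c': "primeideal c' (ring_of_type_algebra :: 'n int_mpoly ring)"
    and "c \<subset> c'" and indep: "polys_in M \<inter> c' \<subseteq> {0}"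
  shows "\<exists>i. i \<notin> M \<and> polys_in (insert i M) \<inter> c \<subseteq> {0}"
proof (rule ccontr)
  assume none: "\<not> ?thesis"
  interpret prime_and_subring "polys_in M" c by (rule prime_and_subring_polys_in[OF c])
  have alg: "algebraic_mod (Var i)" if "i \<notin> M" for i
  proof -
    from none that obtain g where g: "g \<in> polys_in (insert i M)" "g \<in> c" "g \<noteq> 0" by blast
    obtain D where D: "max_degree_le D g" using ex_max_degree_le by blast
    obtain j where j: "j \<le> D" "coeff_in i j g \<noteq> 0" using coeff_in_nonzero[OF g(3) D] by blast
    have "coeff_in i j g \<in> polys_in M" for j using coeff_in_polys_in[OF g(1)] .
    moreover from this j indep have "coeff_in i j g \<notin> c" using \<open>c \<subset> c'\<close> by blast
    moreover have "(\<Sum>j\<le>D. coeff_in i j g * Var i ^ j) \<in> c"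
      using g(2) by (simp only: mpoly_expand[OF D, of i, symmetric])
    ultimately show ?thesis unfolding algebraic_mod_def using j(1)
      by (intro exI[of _ D] exI[of _ "\<lambda>j. coeff_in i j g"]) blast
  qed
  have span: "\<exists>E. finite E \<and> (\<forall>f\<in>polys_in (M \<union> N). generically_spanned E f)"
    if "finite N" "N \<inter> M = {}" for N
    using that
  proof (induction N rule: finite_induct)
    case empty
    have "generically_spanned {1} (f * 1)" if "f \<in> polys_in M" for f
      using that by (intro generically_spanned_mult generically_spanned_base) auto
    then show ?case by (intro exI[of _ "{1}"]) auto
  next
    case (insert i N)
    then obtain E where E: "finite E" "\<And>f. f \<in> polys_in (M \<union> N) \<Longrightarrow> generically_spanned E f" by blast
    have "i \<notin> M" using insert.prems by blast
    have "\<exists>E'. finite E' \<and> (\<forall>b\<in>polys_in (M \<union> N). \<forall>j. generically_spanned E' (b * Var i ^ j))"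
      using E alg[OF \<open>i \<notin> M\<close>] by (rule generically_spanned_adjoin)
    then obtain E' where
      E': "finite E'" "\<And>b j. b \<in> polys_in (M \<union> N) \<Longrightarrow> generically_spanned E' (b * Var i ^ j)"
      by (elim exE conjE) simp
    have "generically_spanned E' f" if f: "f \<in> polys_in (M \<union> insert i N)" for f
    proof -
      obtain D where D: "max_degree_le D f" using ex_max_degree_le by blast
      have "generically_spanned E' (\<Sum>j\<le>D. coeff_in i j f * Var i ^ j)"
        using f by (intro generically_spanned_sum E' coeff_in_polys_in) simp
      then show ?thesis by (simp only: mpoly_expand[OF D, of i, symmetric])
    qed
    with E' show ?case by blast
  qed
  from span[of "- M"] obtain E where E: "finite E" "\<And>f. generically_spanned E f"
    by (auto simp: Compl_partition)
  from \<open>c \<subset> c'\<close> obtain f where f: "f \<in> c'" "f \<notin> c" by blast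
  have "ideal c' (ring_of_type_algebra :: 'n int_mpoly ring)"
    using c' by (rule primeideal.axioms(1))
  note ideal' = ideal_ring_of_type_algebraD[OF this]
  have "algebraic_mod f" using E by (intro algebraic_mod_if_generically_finite)
  from algebraic_element_of_larger_ideal[OF this f _ ideal'(2,3)] \<open>c \<subset> c'\<close>
  obtain a where "a \<in> polys_in M" "a \<in> c'" "a \<notin> c" by blast
  with indep ideal_zero show False by blast
qed

text \<open>
  Walking down the chain from \<open>c n\<close>, each step adds a variable to a set that starts as \<open>J\<close>.
\<close>

lemma prime_chain_length:
  fixes c :: "nat \<Rightarrow> ('n::finite) int_mpoly set"
  assumes prime: "\<forall>i\<le>n. primeideal (c i) (ring_of_type_algebra :: 'n int_mpoly ring)"
    and strict: "\<forall>i<n. c i \<subset> c (Suc i)" and indep: "polys_in J \<inter> c n \<subseteq> {0}"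
  shows "n + card J \<le> CARD('n)"
proof -
  have "\<exists>M. card M = m + card J \<and> polys_in M \<inter> c (n - m) \<subseteq> {0}" if "m \<le> n" for m
    using that
  proof (induction m)
    case 0
    with indep show ?case by auto
  next
    case (Suc m)
    then obtain M where M: "card M = m + card J" "polys_in M \<inter> c (n - m) \<subseteq> {0}" by auto
    have "n - m = Suc (n - Suc m)" using Suc.prems by simp
    then have "c (n - Suc m) \<subset> c (n - m)" using strict Suc.prems by auto
    with M Suc.prems prime obtain i where "i \<notin> M" "polys_in (insert i M) \<inter> c (n - Suc m) \<subseteq> {0}"
      using independent_variables_extend[of "c (n - Suc m)" "c (n - m)" M] by auto
    with M show ?case by (intro exI[of _ "insert i M"]) auto
  qed
  from this[of n] obtain M :: "'n set" where "card M = n + card J" by blast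
  moreover have "card M \<le> CARD('n)" by (rule card_mono) auto
  ultimately show ?thesis by simp
qed

text \<open>
  The elimination statement that carries the codimension: a closed subset of codimension \<open>a\<close> satisfies
  a nontrivial equation in any set of more than \<open>r - a\<close> variables.
\<close>

lemma ideal_meets_few_variables:
  fixes I :: "('n::finite) int_mpoly set"
  assumes I: "closed_subscheme I" and codim: "subscheme_codim I = enat a"
    and J: "card J + a > CARD('n)"
  shows "\<exists>g\<in>I. g \<in> polys_in J \<and> g \<noteq> 0"
proof (rule ccontr)
  assume none: "\<not> ?thesis"
  let ?R = "ring_of_type_algebra :: 'n int_mpoly ring"
  have "\<exists>Q. primeideal Q ?R \<and> I \<subseteq> Q \<and> Q \<inter> (polys_in J - {0}) = {}"
  proof (rule ex_primeideal_avoiding)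
    show "ideal I ?R" using I by (simp add: closed_subscheme_def)
    show "s * t \<in> polys_in J - {0}" if "s \<in> polys_in J - {0}" "t \<in> polys_in J - {0}" for s t
      using that polys_in_mult mpoly_no_zero_divisors by blast
  qed (use none polys_in_one in auto)
  then obtain Q where Q: "primeideal Q ?R" "I \<subseteq> Q" and indep: "polys_in J \<inter> Q \<subseteq> {0}" by blast
  have "enat a \<le> prime_height ?R Q"
    unfolding codim[symmetric] subscheme_codim_def codim_def using Q by (intro INF_lower) auto
  also have "\<dots> \<le> enat (CARD('n) - card J)"
    unfolding prime_height_def
  proof (rule Sup_least, safe)
    fix n c assume "\<forall>i\<le>n. primeideal (c i) ?R" "\<forall>i<n. c i \<subset> c (Suc i)" "Q = c n"
    with indep have "n + card J \<le> CARD('n)" by (intro prime_chain_length) auto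
    then show "enat n \<le> enat (CARD('n) - card J)" by simp
  qed
  finally have "a \<le> CARD('n) - card J" by simp
  moreover have "card J \<le> CARD('n)" by (rule card_mono) auto
  ultimately show False using J by simp
qed

section \<open>Common zeros modulo a prime in a box\<close>

text \<open>
  Lagrange's theorem over \<open>\<F>\<^sub>p\<close>, phrased with integers. Splitting off the linear factor of one root
  keeps the leading coefficient, so that the quotient is again nonzero modulo \<open>p\<close>; if \<open>p\<close> divides the
  leading coefficient, the degree drops instead.
\<close>

lemma card_incongruent_roots_mod_prime:
  fixes a :: "nat \<Rightarrow> int" and p :: nat
  assumes "Factorial_Ring.prime p" "finite R" "\<exists>j\<le>n. \<not> int p dvd a j"
    and "\<And>t. t \<in> R \<Longrightarrow> int p dvd (\<Sum>j\<le>n. a j * t ^ j)" "inj_on (\<lambda>t. t mod int p) R"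
  shows "card R \<le> n"
  using assms(2-)
proof (induction n arbitrary: a R)
  case 0
  then have "R = {}" by auto
  then show ?case by simp
next
  case (Suc n)
  show ?case
  proof (cases "int p dvd a (Suc n)")
    case True
    have "int p dvd (\<Sum>j\<le>n. a j * t ^ j)" if "t \<in> R" for t
      using Suc.prems(3)[OF that] True by (simp add: dvd_add_left_iff)
    moreover have "\<exists>j\<le>n. \<not> int p dvd a j"
      using Suc.prems(2) True by (metis le_Suc_eq)
    ultimately have "card R \<le> n" using Suc.prems by (intro Suc.IH[of R a]) auto
    then show ?thesis by simp
  next
    case False
    show ?thesis
    proof (cases "R = {}")
      case nonempty: False
      then obtain s where s: "s \<in> R" by blast
      define b where "b j = (\<Sum>i=Suc j..Suc n. a i * s ^ (i - j - 1))" for j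
      have "int p dvd (\<Sum>j\<le>n. b j * t ^ j)" if t: "t \<in> R - {s}" for t
      proof -
        have "(\<Sum>j\<le>Suc n. a j * t ^ j) - (\<Sum>j\<le>Suc n. a j * s ^ j) =
            (t - s) * (\<Sum>j<Suc n. b j * t ^ j)"
          unfolding b_def by (rule polyfun_diff) simp
        moreover have "int p dvd (\<Sum>j\<le>Suc n. a j * t ^ j) - (\<Sum>j\<le>Suc n. a j * s ^ j)"
          using Suc.prems(3)[of t] Suc.prems(3)[OF s] t by (intro dvd_diff) auto
        ultimately have "int p dvd (t - s) * (\<Sum>j\<le>n. b j * t ^ j)"
          by (simp add: lessThan_Suc_atMost)
        moreover have "\<not> int p dvd t - s"
        proof
          assume "int p dvd t - s"
          then have "t mod int p = s mod int p" by (simp add: mod_eq_dvd_iff)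
          with t s Suc.prems(4) show False by (auto dest: inj_onD)
        qed
        ultimately show ?thesis
          using assms(1) prime_dvd_mult_iff[of "int p"] by simp
      qed
      moreover have "b n = a (Suc n)" by (simp add: b_def)
      ultimately have "card (R - {s}) \<le> n"
        using Suc.prems False by (intro Suc.IH[of "R - {s}" b]) (auto intro: inj_on_subset)
      then show ?thesis using s Suc.prems(1) by (simp add: card_Diff_singleton)
    qed simp
  qed
qed

lemma card_roots_mod_prime:
  fixes a :: "nat \<Rightarrow> int" and p :: nat
  assumes p: "Factorial_Ring.prime p" and "finite S" and a: "\<exists>j\<le>n. \<not> int p dvd a j"
    and K: "\<And>q. card {t\<in>S. t mod int p = q} \<le> K"
  shows "card {t\<in>S. int p dvd (\<Sum>j\<le>n. a j * t ^ j)} \<le> n * K"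
proof -
  let ?Z = "{t\<in>S. int p dvd (\<Sum>j\<le>n. a j * t ^ j)}"
  let ?Q = "(\<lambda>t. t mod int p) ` ?Z"
  have fin: "finite ?Z" using \<open>finite S\<close> by simp
  have dvd_mod: "int p dvd (\<Sum>j\<le>n. a j * (t mod int p) ^ j) \<longleftrightarrow> int p dvd (\<Sum>j\<le>n. a j * t ^ j)" for t
    by (intro cong_dvd_iff cong_sum cong_mult cong_pow cong_refl) (simp add: cong_def)
  have "card ?Q \<le> n"
    using fin dvd_mod by (intro card_incongruent_roots_mod_prime[OF p _ a]) (auto intro!: inj_onI)
  have "?Z = (\<Union>q\<in>?Q. {t\<in>?Z. t mod int p = q})" by auto
  then have "card ?Z \<le> (\<Sum>q\<in>?Q. card {t\<in>?Z. t mod int p = q})"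
    using card_UN_le[of ?Q "\<lambda>q. {t\<in>?Z. t mod int p = q}"] fin by simp
  also have "\<dots> \<le> (\<Sum>q\<in>?Q. K)"
  proof (intro sum_mono order_trans[OF card_mono K])
    show "finite {t\<in>S. t mod int p = q}" for q using \<open>finite S\<close> by simp
  qed auto
  also have "\<dots> \<le> n * K" using \<open>card ?Q \<le> n\<close> by simp
  finally show ?thesis .
qed

text \<open>
  Induction on the set \<open>U\<close> of variables, projecting away one coordinate \<open>i\<close>. The projection of a
  common zero is a common zero of the \<open>g J\<close> with \<open>J \<subseteq> U\<close>. If over a projected point some
  \<open>g (insert i J)\<close> with \<open>|J| = k - 1\<close> is still a nonzero polynomial in \<open>x\<^sub>i\<close>, there are at most \<open>D * K\<close>
  points above it. Otherwise the point is a common zero of chosen nonzero coefficients of these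
  polynomials, which form a family of the same kind for \<open>k - 1\<close>; there are fewer such points by a
  factor \<open>T\<close>, which compensates for the up to \<open>T\<close> points above each of them. For \<open>k = 0\<close> the
  polynomial \<open>g {}\<close> is a constant not divisible by \<open>p\<close>, so there are no zeros at all.
\<close>

lemma card_common_zeros_mod_prime:
  fixes S :: "'n::finite \<Rightarrow> int set" and g :: "'n set \<Rightarrow> 'n int_mpoly" and p :: nat and T :: real
  assumes p: "Factorial_Ring.prime p" and finS: "\<And>i. finite (S i)"
    and cardS: "\<And>i. real (card (S i)) \<le> T" and "1 \<le> T"
    and K: "\<And>i q. card {t\<in>S i. t mod int p = q} \<le> K"
    and g: "\<And>J. J \<subseteq> U \<Longrightarrow> card J = k \<Longrightarrow> g J \<in> polys_in J"
      "\<And>J. J \<subseteq> U \<Longrightarrow> card J = k \<Longrightarrow> max_degree_le D (g J)"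
      "\<And>J. J \<subseteq> U \<Longrightarrow> card J = k \<Longrightarrow> \<exists>e. \<not> int p dvd Poly_Mapping.lookup (g J) e"
  shows "real (card {y\<in>PiE U S. \<forall>J\<subseteq>U. card J = k \<longrightarrow> int p dvd eval_int_mpoly (g J) (\<chi> i. y i)})
    \<le> real (D * K + 1) ^ card U * (if k = 0 then 0 else T ^ (k - 1))"
proof -
  define Z where "Z U k g =
    {y\<in>PiE U S. \<forall>J\<subseteq>U. card J = k \<longrightarrow> int p dvd eval_int_mpoly (g J) (\<chi> i. y i)}"
    for U k and g :: "'n set \<Rightarrow> 'n int_mpoly"
  have "finite U" by simp
  then have "real (card (Z U k g)) \<le> real (D * K + 1) ^ card U * (if k = 0 then 0 else T ^ (k - 1))"
    using g
  proof (induction U arbitrary: k g rule: finite_induct)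
    case (empty k g)
    show ?case
    proof (cases "k = 0")
      case True
      with empty obtain e where e: "g {} \<in> polys_in {}" "\<not> int p dvd Poly_Mapping.lookup (g {}) e"
        by auto
      then have "e = 0" using polys_in_empty(1)[OF e(1), of e] by (metis dvd_0_right)
      with e have "Z {} k g = {}" using True by (auto simp: Z_def polys_in_empty(2))
      then show ?thesis using True by simp
    next
      case False
      have "card (Z {} k g) \<le> card (PiE {} S)" by (intro card_mono) (auto simp: Z_def)
      also have "\<dots> = 1" by simp
      finally have "real (card (Z {} k g)) \<le> 1" by simp
      also have "1 \<le> T ^ (k - 1)" using \<open>1 \<le> T\<close> by (rule one_le_power)
      finally show ?thesis using False by simp
    qed
  next
    case (insert i U k g)
    let ?c = "real (D * K + 1) ^ card U"
    have finPi: "finite (PiE V S)" for V using finS by (intro finite_PiE) auto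
    have finZ: "finite (Z V k g)" for V k g by (rule finite_subset[OF _ finPi[of V]]) (auto simp: Z_def)
    have Z': "real (card (Z U k g)) \<le> ?c * (if k = 0 then 0 else T ^ (k - 1))"
      by (rule insert.IH; rule insert.prems; blast)
    show ?case
    proof (cases "k = 0")
      case True
      have "Z (insert i U) k g = {}"
      proof -
        obtain e where e: "g {} \<in> polys_in {}" "\<not> int p dvd Poly_Mapping.lookup (g {}) e"
          using insert.prems True by (metis card.empty empty_subsetI)
        then have "e = 0" using polys_in_empty(1)[OF e(1), of e] by (metis dvd_0_right)
        with e show ?thesis using True by (auto simp: Z_def polys_in_empty(2))
      qed
      then show ?thesis using True by simp
    next
      case False
      have card_insert: "card (insert i J) = k" "insert i J \<subseteq> insert i U" if "J \<subseteq> U" "card J = k - 1" for J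
        using that False insert.hyps by (auto simp: card_insert_if finite_subset)
      have "\<exists>j. \<exists>e. \<not> int p dvd Poly_Mapping.lookup (coeff_in i j (g (insert i J))) e"
        if J: "J \<subseteq> U" "card J = k - 1" for J
      proof -
        from insert.prems(3)[OF card_insert(2,1)[OF J]] obtain e where
          e: "\<not> int p dvd Poly_Mapping.lookup (g (insert i J)) e" by blast
        then have "e \<in> Poly_Mapping.keys (g (insert i J))" by (auto simp: in_keys_iff)
        with e show ?thesis using lookup_coeff_in[OF refl] by metis
      qed
      then obtain j where j: "\<And>J. J \<subseteq> U \<Longrightarrow> card J = k - 1 \<Longrightarrow>
          \<exists>e. \<not> int p dvd Poly_Mapping.lookup (coeff_in i (j J) (g (insert i J))) e" by metis
      define h where "h J = coeff_in i (j J) (g (insert i J))" for J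
      have Bad: "real (card (Z U (k - 1) h)) \<le> ?c * (if k - 1 = 0 then 0 else T ^ (k - 1 - 1))"
      proof (rule insert.IH)
        fix J assume J: "J \<subseteq> U" "card J = k - 1"
        show "h J \<in> polys_in J" "max_degree_le D (h J)"
          unfolding h_def using insert.prems(1,2)[OF card_insert(2,1)[OF J]]
          by (auto intro: coeff_in_polys_in max_degree_le_coeff_in)
        show "\<exists>e. \<not> int p dvd Poly_Mapping.lookup (h J) e" unfolding h_def using j J by blast
      qed
      define R where "R y = {t\<in>S i. \<forall>J\<subseteq>U. card J = k - 1 \<longrightarrow>
          int p dvd eval_int_mpoly (g (insert i J)) (\<chi> l. (y(i := t)) l)}" for y
      have R: "card (R y) \<le> D * K" if y: "y \<in> PiE U S" "y \<notin> Z U (k - 1) h" for y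
      proof -
        from y obtain J where J: "J \<subseteq> U" "card J = k - 1"
          "\<not> int p dvd eval_int_mpoly (h J) (\<chi> l. y l)" by (auto simp: Z_def)
        let ?f = "g (insert i J)"
        note f = insert.prems(1,2)[OF card_insert(2,1)[OF J(1,2)]]
        let ?a = "\<lambda>j. eval_int_mpoly (coeff_in i j ?f) (\<chi> l. y l)"
        have "i \<notin> J" using J insert.hyps by blast
        have "(\<chi> l. (y(i := t)) l) = (\<chi> l. if l = i then t else (\<chi> l. y l) $ l)" for t
          by (simp add: vec_eq_iff)
        then have eval: "eval_int_mpoly ?f (\<chi> l. (y(i := t)) l) = (\<Sum>j\<le>D. ?a j * t ^ j)" for t
          using eval_int_mpoly_update[OF f \<open>i \<notin> J\<close>, of t "\<chi> l. y l"] by simp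
        have "j J \<le> D"
        proof (rule ccontr)
          assume "\<not> j J \<le> D"
          then have "Poly_Mapping.lookup e i \<noteq> j J" if "e \<in> Poly_Mapping.keys ?f" for e
            using f(2) that unfolding max_degree_le_def by metis
          then have "{e \<in> Poly_Mapping.keys ?f. Poly_Mapping.lookup e i = j J} = {}" by blast
          then have "h J = 0" unfolding h_def coeff_in_def by (simp only: sum.empty)
          with J(3) show False by (simp add: eval_int_mpoly_zero)
        qed
        then have "\<exists>j\<le>D. \<not> int p dvd ?a j" using J(3) unfolding h_def by blast
        then have "card {t\<in>S i. int p dvd (\<Sum>j\<le>D. ?a j * t ^ j)} \<le> D * K"
          by (intro card_roots_mod_prime p finS K)
        moreover have "R y \<subseteq> {t\<in>S i. int p dvd (\<Sum>j\<le>D. ?a j * t ^ j)}"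
        proof
          fix t assume "t \<in> R y"
          then have "t \<in> S i" "int p dvd eval_int_mpoly ?f (\<chi> l. (y(i := t)) l)"
            using J(1,2) unfolding R_def by blast+
          then show "t \<in> {t\<in>S i. int p dvd (\<Sum>j\<le>D. ?a j * t ^ j)}"
            unfolding eval by blast
        qed
        ultimately show ?thesis
          using card_mono[of "{t\<in>S i. int p dvd (\<Sum>j\<le>D. ?a j * t ^ j)}" "R y"] finS[of i] by simp
      qed
      \<comment> \<open>\<open>W\<close> lists the pairs of a projected point and a candidate for the coordinate \<open>i\<close>: few
        candidates above a good point, the whole side above a bad one.\<close>
      define W where "W = Sigma (Z U k g - Z U (k - 1) h) R \<union> Sigma (Z U (k - 1) h) (\<lambda>_. S i)"
      have finR: "finite (R y)" for y using finS by (simp add: R_def)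
      have finW: "finite W" unfolding W_def using finZ finR finS by auto
      have "Z (insert i U) k g \<subseteq> (\<lambda>(y, t). y(i := t)) ` W"
      proof
        fix y assume y: "y \<in> Z (insert i U) k g"
        then have yPi: "y \<in> PiE (insert i U) S" by (simp add: Z_def)
        define y' where "y' = y(i := undefined)"
        have y': "y' \<in> PiE U S" "y = y'(i := y i)"
          using yPi insert.hyps by (auto simp: y'_def PiE_def extensional_def)
        have "int p dvd eval_int_mpoly (g J) (\<chi> l. y' l)" if J: "J \<subseteq> U" "card J = k" for J
        proof -
          have "eval_int_mpoly (g J) (\<chi> l. y' l) = eval_int_mpoly (g J) (\<chi> l. y l)"
            using J insert.prems(1)[of J] insert.hyps
            by (intro eval_int_mpoly_cong[of _ J]) (auto simp: y'_def)
          with y J show ?thesis by (auto simp: Z_def)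
        qed
        with y' have "y' \<in> Z U k g" by (simp add: Z_def)
        moreover have "y i \<in> R y'"
          using y y'(2) yPi card_insert unfolding R_def Z_def by auto
        moreover have "y i \<in> S i" using yPi by auto
        ultimately have "(y', y i) \<in> W" by (auto simp: W_def)
        then show "y \<in> (\<lambda>(y, t). y(i := t)) ` W" using y'(2) by (intro image_eqI[of _ _ "(y', y i)"]) auto
      qed
      then have "card (Z (insert i U) k g) \<le> card W"
        by (rule surj_card_le[OF finW])
      also have "\<dots> \<le> card (Sigma (Z U k g - Z U (k - 1) h) R) + card (Sigma (Z U (k - 1) h) (\<lambda>_. S i))"
        unfolding W_def by (rule card_Un_le)
      also have "card (Sigma (Z U k g - Z U (k - 1) h) R) =
          (\<Sum>y\<in>Z U k g - Z U (k - 1) h. card (R y))"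
        using finZ finR by (intro card_SigmaI) auto
      also have "\<dots> \<le> (\<Sum>y\<in>Z U k g - Z U (k - 1) h. D * K)"
        by (intro sum_mono R) (auto simp: Z_def)
      also have "\<dots> \<le> card (Z U k g) * (D * K)"
        using finZ by (simp add: card_mono)
      finally have "real (card (Z (insert i U) k g)) \<le>
          real (card (Z U k g) * (D * K) + card (Sigma (Z U (k - 1) h) (\<lambda>_. S i)))" by (simp only: of_nat_le_iff)
      also have "\<dots> = real (card (Z U k g)) * real (D * K) + real (card (Z U (k - 1) h)) * real (card (S i))"
        by (simp add: card_cartesian_product)
      also have "\<dots> \<le> (?c * T ^ (k - 1)) * real (D * K) + ?c * T ^ (k - 1)"
      proof (intro add_mono mult_right_mono)
        have "real (card (Z U (k - 1) h)) * real (card (S i)) \<le>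
            (?c * (if k - 1 = 0 then 0 else T ^ (k - 1 - 1))) * T"
          using Bad cardS \<open>1 \<le> T\<close> by (intro mult_mono) auto
        also have "\<dots> \<le> ?c * T ^ (k - 1)"
        proof (cases "k - 1")
          case (Suc n)
          then show ?thesis by simp
        qed simp
        finally show "real (card (Z U (k - 1) h)) * real (card (S i)) \<le> ?c * T ^ (k - 1)" .
      qed (use Z' False in auto)
      also have "\<dots> = real (D * K + 1) ^ card (insert i U) * T ^ (k - 1)"
        using insert.hyps by (simp add: algebra_simps)
      finally show ?thesis using False by simp
    qed
  qed
  then show ?thesis by (simp add: Z_def)
qed

lemma card_residue_class_le:
  fixes d c :: int and L :: real
  assumes "d > 0" "L \<ge> 0"
  shows "finite {t. \<bar>real_of_int t\<bar> \<le> L \<and> t mod d = c}"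
    and "real (card {t. \<bar>real_of_int t\<bar> \<le> L \<and> t mod d = c}) \<le> 2 * L / real_of_int d + 1"
proof -
  let ?A = "{t. \<bar>real_of_int t\<bar> \<le> L \<and> t mod d = c}"
  let ?u = "(- L - real_of_int c) / real_of_int d" and ?v = "(L - real_of_int c) / real_of_int d"
  have inj: "inj_on (\<lambda>t. t div d) ?A"
    by (intro inj_onI) (metis (mono_tags, lifting) div_mult_mod_eq mem_Collect_eq)
  have sub: "(\<lambda>t. t div d) ` ?A \<subseteq> {\<lceil>?u\<rceil>..\<lfloor>?v\<rfloor>}"
  proof safe
    fix t assume t: "\<bar>real_of_int t\<bar> \<le> L"
    have "t = t div d * d + t mod d" by simp
    then have "real_of_int t = real_of_int (t div d) * real_of_int d + real_of_int (t mod d)"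
      by (metis of_int_add of_int_mult)
    then have eq: "real_of_int (t div d) = (real_of_int t - real_of_int (t mod d)) / real_of_int d"
      using \<open>d > 0\<close> by (simp add: field_simps)
    show "t div d \<in> {\<lceil>(- L - real_of_int (t mod d)) / real_of_int d\<rceil>..
        \<lfloor>(L - real_of_int (t mod d)) / real_of_int d\<rfloor>}"
      using t \<open>d > 0\<close> unfolding atLeastAtMost_iff ceiling_le_iff le_floor_iff eq
      by (auto intro!: divide_right_mono)
  qed
  show "finite ?A" using inj sub by (meson finite_imageD finite_subset finite_atLeastAtMost_int)
  have "card ?A = card ((\<lambda>t. t div d) ` ?A)" using inj by (simp add: card_image)
  also have "\<dots> \<le> card {\<lceil>?u\<rceil>..\<lfloor>?v\<rfloor>}" using sub by (intro card_mono) auto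
  finally have "real (card ?A) \<le> real (nat (\<lfloor>?v\<rfloor> - \<lceil>?u\<rceil> + 1))" by simp
  also have "\<dots> \<le> max 0 (?v - ?u + 1)" by linarith
  also have "?v - ?u = 2 * L / real_of_int d" using \<open>d > 0\<close> by (simp add: field_simps)
  finally show "real (card ?A) \<le> 2 * L / real_of_int d + 1"
    using assms by simp
qed

lemma eval_int_mpoly_mod_cong:
  assumes "\<And>i. [x $ i = y $ i] (mod q)"
  shows "[eval_int_mpoly f x = eval_int_mpoly f y] (mod q)"
  unfolding eval_int_mpoly_def using assms
  by (intro cong_sum cong_mult cong_prod cong_pow cong_refl)

section \<open>The sieve bound\<close>

text \<open>
  The possible values of the \<open>i\<close>-th coordinate of a point counted by the sieve, if \<open>B\<close> lies in the
  ball of radius \<open>b\<close>.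
\<close>

definition residue_box :: "nat \<Rightarrow> real \<Rightarrow> nat \<Rightarrow> int ^ 'n \<Rightarrow> 'n::finite \<Rightarrow> int set" where
  "residue_box b lam m x0 i =
     {t. \<bar>real_of_int t\<bar> \<le> real b * lam \<and> t mod int m = (x0 $ i) mod int m}"

lemma card_residue_box:
  assumes "m > 0" "lam / real m > 1"
  shows "finite (residue_box b lam m x0 i)"
    and "real (card (residue_box b lam m x0 i)) \<le> real (2 * b + 1) * (lam / real m)"
proof -
  have "lam \<ge> 0" using assms by (simp add: field_simps)
  then have L: "real b * lam \<ge> 0" by simp
  note * = card_residue_class_le[of "int m" "real b * lam" "(x0 $ i) mod int m", OF _ L]
  show "finite (residue_box b lam m x0 i)"
    unfolding residue_box_def using *(1) assms(1) by simp
  have "real (card (residue_box b lam m x0 i)) \<le> 2 * (real b * lam) / real m + 1"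
    unfolding residue_box_def using *(2) assms(1) by simp
  also have "\<dots> \<le> real (2 * b + 1) * (lam / real m)"
    using assms(2) by (simp add: algebra_simps)
  finally show "real (card (residue_box b lam m x0 i)) \<le> real (2 * b + 1) * (lam / real m)" .
qed

text \<open>
  By the Chinese remainder theorem the elements lie in one residue class modulo \<open>p * m\<close>, whose gaps
  are at least as long as \<open>\<lambda>\<close>.
\<close>

lemma card_residue_box_class:
  assumes "m > 0" "lam / real m > 1" and p: "Factorial_Ring.prime p" "\<not> p dvd m" "lam / real m \<le> real p"
  shows "card {t\<in>residue_box b lam m x0 i. t mod int p = q} \<le> 2 * b + 1"
proof (cases "{t\<in>residue_box b lam m x0 i. t mod int p = q} = {}")
  case False
  then obtain s where s: "s \<in> residue_box b lam m x0 i" "s mod int p = q" by blast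
  have "p > 0" using p(1) by (rule prime_gt_0_nat)
  have "lam \<ge> 0" using assms by (simp add: field_simps)
  then have L: "real b * lam \<ge> 0" by simp
  have d: "int p * int m > 0" using \<open>p > 0\<close> \<open>m > 0\<close> by simp
  let ?A = "{t. \<bar>real_of_int t\<bar> \<le> real b * lam \<and> t mod (int p * int m) = s mod (int p * int m)}"
  note A = card_residue_class_le[OF d L, of "s mod (int p * int m)"]
  have "coprime (int p) (int m)" using p by (simp add: prime_imp_coprime)
  then have "[t = s] (mod int p * int m)"
    if "t \<in> residue_box b lam m x0 i" "t mod int p = q" for t
    using that s by (intro coprime_cong_mult) (auto simp: cong_def residue_box_def)
  then have "{t\<in>residue_box b lam m x0 i. t mod int p = q} \<subseteq> ?A"
    by (auto simp: cong_def residue_box_def)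
  then have "card {t\<in>residue_box b lam m x0 i. t mod int p = q} \<le> card ?A"
    using A(1) by (intro card_mono)
  then have "real (card {t\<in>residue_box b lam m x0 i. t mod int p = q}) \<le>
      2 * (real b * lam) / real_of_int (int p * int m) + 1"
    using A(2) by linarith
  also have "2 * (real b * lam) / real_of_int (int p * int m) = 2 * real b * (lam / real m / real p)"
    using \<open>p > 0\<close> \<open>m > 0\<close> by (simp add: field_simps)
  also have "\<dots> + 1 \<le> 2 * real b * 1 + 1"
  proof (intro add_mono mult_left_mono)
    show "lam / real m / real p \<le> 1"
      using p(3) \<open>p > 0\<close> by (subst pos_divide_le_eq) auto
  qed auto
  finally have "real (card {t\<in>residue_box b lam m x0 i. t mod int p = q}) \<le> real (2 * b + 1)" by simp
  then show ?thesis by (simp only: of_nat_le_iff)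
next
  case True
  show ?thesis unfolding True by simp
qed

lemma sieve_set_residue_box:
  assumes "(x, p) \<in> sieve_set B I lam m x0 P" and B: "\<And>v. v \<in> B \<Longrightarrow> norm v \<le> real b" and "lam > 0"
  shows "x $ i \<in> residue_box b lam m x0 i"
proof -
  from assms(1) obtain v z where v: "v \<in> B" "real_point x = lam *\<^sub>R v" and z: "x = x0 + int m *s z"
    unfolding sieve_set_def by auto
  have "real_of_int (x $ i) = lam * v $ i"
    using arg_cong[OF v(2), of "\<lambda>w. w $ i"] by (simp add: real_point_def)
  moreover have "\<bar>v $ i\<bar> \<le> real b" using component_le_norm_cart[of v i] B[OF v(1)] by linarith
  ultimately have "\<bar>real_of_int (x $ i)\<bar> \<le> real b * lam"
    using \<open>lam > 0\<close> by (simp add: abs_mult mult.commute)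
  then show ?thesis by (simp add: residue_box_def z)
qed

lemma sieve_set_dvd:
  assumes "(x, p) \<in> sieve_set B I lam m x0 P" "g \<in> I"
  shows "int p dvd eval_int_mpoly g x"
proof -
  have "[eval_int_mpoly g (reduce_mod p x) = 0] (mod int p)"
    using assms by (auto simp: sieve_set_def Fp_points_def)
  moreover have "[eval_int_mpoly g (reduce_mod p x) = eval_int_mpoly g x] (mod int p)"
    by (rule eval_int_mpoly_mod_cong) (simp add: reduce_mod_def cong_def)
  ultimately have "[eval_int_mpoly g x = 0] (mod int p)" by (meson cong_sym cong_trans)
  then show ?thesis by (simp add: cong_0_iff)
qed

text \<open>
  There are at most \<open>2 * P\<close> positive integers up to \<open>2 * P\<close>, which is a sufficient bound for the number
  of primes.
\<close>

lemma card_sieve_set_le: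
  assumes F: "\<And>p. finite (F p)"
      "\<And>p. Factorial_Ring.prime p \<Longrightarrow> P \<le> real p \<Longrightarrow> \<not> p dvd m \<Longrightarrow>
        real (card (F p)) \<le> N"
    and sub: "\<And>x p. (x, p) \<in> sieve_set B I lam m x0 P \<Longrightarrow> x \<in> F p"
    and "P > 0" "N \<ge> 0"
  shows "finite (sieve_set B I lam m x0 P) \<and> real (card (sieve_set B I lam m x0 P)) \<le> 2 * P * N"
proof -
  let ?Q = "{p\<in>{1..nat \<lfloor>2 * P\<rfloor>}. Factorial_Ring.prime p \<and> P \<le> real p \<and> \<not> p dvd m}"
  let ?X = "\<lambda>p. (\<lambda>x. (x, p)) ` F p"
  have "sieve_set B I lam m x0 P \<subseteq> (\<Union>p\<in>?Q. ?X p)"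
  proof safe
    fix x p assume xp: "(x, p) \<in> sieve_set B I lam m x0 P"
    then have p: "Factorial_Ring.prime p" "P \<le> real p" "real p \<le> 2 * P" "\<not> p dvd m"
      by (auto simp: sieve_set_def)
    have "p \<le> nat \<lfloor>2 * P\<rfloor>" using p(3) by (simp add: le_nat_floor)
    then have "p \<in> ?Q" using p prime_ge_1_nat[of p] by simp
    with sub[OF xp] show "(x, p) \<in> (\<Union>p\<in>?Q. ?X p)" by blast
  qed
  moreover have fin: "finite (\<Union>p\<in>?Q. ?X p)" using F(1) by simp
  ultimately have "finite (sieve_set B I lam m x0 P)"
    and "card (sieve_set B I lam m x0 P) \<le> card (\<Union>p\<in>?Q. ?X p)"
    by (rule finite_subset, intro card_mono)
  moreover have "real (card (\<Union>p\<in>?Q. ?X p)) \<le> 2 * P * N"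
  proof -
    have "card (\<Union>p\<in>?Q. ?X p) \<le> (\<Sum>p\<in>?Q. card (?X p))" by (rule card_UN_le) simp
    also have "\<dots> = (\<Sum>p\<in>?Q. card (F p))"
      by (rule sum.cong[OF refl card_image]) (auto intro: inj_onI)
    finally have "real (card (\<Union>p\<in>?Q. ?X p)) \<le> (\<Sum>p\<in>?Q. real (card (F p)))"
      by (simp flip: of_nat_sum)
    also have "\<dots> \<le> (\<Sum>p\<in>?Q. N)" using F(2) by (intro sum_mono) auto
    also have "\<dots> = real (card ?Q) * N" by simp
    also have "card ?Q \<le> card {1..nat \<lfloor>2 * P\<rfloor>}" by (intro card_mono) auto
    then have "real (card ?Q) \<le> 2 * P" using \<open>P > 0\<close> by (simp add: le_nat_floor) linarith
    then have "real (card ?Q) * N \<le> 2 * P * N" using \<open>N \<ge> 0\<close> by (rule mult_right_mono)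
    finally show ?thesis .
  qed
  ultimately show ?thesis by linarith
qed

theorem theorem11:
  fixes B :: "(real ^ 'n::finite) set"
    and I :: "'n int_mpoly set"
    and a :: nat
    and \<epsilon> :: real
  assumes "compact B"
    and "closed_subscheme I"
    and "subscheme_codim I = enat a"
    and "a \<ge> 1"
    and "\<epsilon> > 0"
  shows "\<exists>C::real. \<forall>(lam::real) (m::nat) (x0::int ^ 'n) (P::real).
           lam > 0 \<longrightarrow> m > 0 \<longrightarrow> P > lam / real m \<longrightarrow> lam / real m > 1 \<longrightarrow>
             finite (sieve_set B I lam m x0 P) \<and>
             real (card (sieve_set B I lam m x0 P))
               \<le> C * ((lam / real m) powi (int CARD('n) - int a) * P * lam powr \<epsilon>)"
proof -
  from compact_imp_bounded[OF \<open>compact B\<close>] obtain b0 where b0: "\<And>v. v \<in> B \<Longrightarrow> norm v \<le> b0"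
    unfolding bounded_iff by blast
  define b where "b = nat \<lceil>b0\<rceil>"
  have b: "norm v \<le> real b" if "v \<in> B" for v
    using b0[OF that] unfolding b_def by linarith
  \<comment> \<open>The subtraction is truncated: for \<open>a > r\<close> the ideal contains a nonzero constant, \<open>g {}\<close>.\<close>
  define k where "k = CARD('n) + 1 - a"
  have "\<forall>J::'n set. \<exists>g D e. card J = k \<longrightarrow>
      g \<in> I \<and> g \<in> polys_in J \<and> max_degree_le D g \<and> Poly_Mapping.lookup g e \<noteq> 0"
  proof
    fix J :: "'n set"
    show "\<exists>g D e. card J = k \<longrightarrow>
      g \<in> I \<and> g \<in> polys_in J \<and> max_degree_le D g \<and> Poly_Mapping.lookup g e \<noteq> 0"
    proof (cases "card J = k")
      case True
      then have "card J + a > CARD('n)" by (simp add: k_def)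
      from ideal_meets_few_variables[OF assms(2,3) this] obtain g where
        g: "g \<in> I" "g \<in> polys_in J" "g \<noteq> 0" by blast
      obtain D where "max_degree_le D g" using ex_max_degree_le by blast
      moreover obtain e where "Poly_Mapping.lookup g e \<noteq> 0"
        using g(3) by (metis lookup_zero poly_mapping_eqI)
      ultimately show ?thesis using g by blast
    qed simp
  qed
  then obtain g D' e where g: "\<And>J. card J = k \<Longrightarrow> g J \<in> I" "\<And>J. card J = k \<Longrightarrow> g J \<in> polys_in J"
    and D': "\<And>J. card J = k \<Longrightarrow> max_degree_le (D' J) (g J)"
    and e: "\<And>J. card J = k \<Longrightarrow> Poly_Mapping.lookup (g J) (e J) \<noteq> 0" by metis
  define D where "D = (\<Sum>J\<in>UNIV. D' J)"
  have D: "max_degree_le D (g J)" if "card J = k" for J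
    using max_degree_le_mono[OF D'[OF that]] by (simp add: D_def member_le_sum)
  \<comment> \<open>A prime above \<open>p0\<close> exceeds the nonzero coefficient of each \<open>g J\<close> at \<open>e J\<close>, and so does not divide it.\<close>
  define p0 where "p0 = (\<Sum>J\<in>UNIV. nat \<bar>Poly_Mapping.lookup (g J) (e J)\<bar>) + 1"
  have not_dvd: "\<not> int p dvd Poly_Mapping.lookup (g J) (e J)" if "card J = k" "p > p0" for p J
  proof
    assume "int p dvd Poly_Mapping.lookup (g J) (e J)"
    from dvd_imp_le_int[OF e[OF that(1)] this]
    have "int p \<le> \<bar>Poly_Mapping.lookup (g J) (e J)\<bar>" by simp
    moreover have "nat \<bar>Poly_Mapping.lookup (g J) (e J)\<bar> \<le> p0"
      unfolding p0_def by (intro trans_le_add1 member_le_sum) auto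
    ultimately show False using that(2) by linarith
  qed
  define r where "r = CARD('n)"
  \<comment> \<open>\<open>c1\<close> serves for \<open>P \<le> p0\<close>, where \<open>T\<^sup>r = T\<^sup>a T\<^bsup>r-a\<^esup> \<le> p0\<^sup>a T\<^bsup>r-a\<^esup>\<close>, and \<open>c2\<close> for larger \<open>P\<close>.\<close>
  define c1 where "c1 = real (2 * b + 1) ^ r * real p0 ^ a"
  define c2 where "c2 = real (D * (2 * b + 1) + 1) ^ r * real (2 * b + 1) ^ (k - 1)"
  have "c1 \<ge> 0" "c2 \<ge> 0" unfolding c1_def c2_def by auto
  show ?thesis
  proof (intro exI[of _ "2 * (c1 + c2)"] allI impI)
    fix lam :: real and m :: nat and x0 :: "int ^ 'n" and P :: real
    assume lam: "lam > 0" and m: "m > 0" and P: "P > lam / real m" and T: "lam / real m > 1"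
    define T where "T = lam / real m"
    let ?S = "residue_box b lam m x0"
    let ?vec = "\<lambda>y. (\<chi> i. y i) :: int ^ 'n"
    let ?box = "PiE UNIV ?S"
    have finbox: "finite ?box" using card_residue_box(1)[OF m T] by (intro finite_PiE) auto
    have cardS: "real (card (?S i)) \<le> real (2 * b + 1) * T" for i
      unfolding T_def by (rule card_residue_box(2)[OF m T])
    have "P > 0" using P T by linarith
    have "1 < T" using T by (simp add: T_def)
    define F where "F p = ?vec ` {y\<in>?box. \<forall>J. card J = k \<longrightarrow> int p dvd eval_int_mpoly (g J) (?vec y)}" for p
    have finF: "finite (F p)" for p unfolding F_def using finbox by simp
    have sub: "x \<in> F p" if "(x, p) \<in> sieve_set B I lam m x0 P" for x p
    proof -
      have "?vec (($) x) = x" by simp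
      moreover have "($) x \<in> ?box" using sieve_set_residue_box[OF that b lam] by auto
      ultimately show ?thesis unfolding F_def
        using sieve_set_dvd[OF that g(1)] by (intro image_eqI[of _ _ "($) x"]) auto
    qed
    have cardF: "real (card (F p)) \<le> (c1 + c2) * T powi (int r - int a)"
      if p: "Factorial_Ring.prime p" "P \<le> real p" "\<not> p dvd m" for p
    proof (cases "P \<le> real p0")
      case True
      have "card (F p) \<le> card ?box"
        unfolding F_def using finbox by (intro order_trans[OF card_image_le] card_mono) auto
      also have "\<dots> = (\<Prod>i\<in>UNIV. card (?S i))" by (simp add: card_PiE)
      finally have "real (card (F p)) \<le> (\<Prod>i\<in>UNIV. real (card (?S i)))"
        by (metis of_nat_le_iff of_nat_prod)
      also have "\<dots> \<le> (\<Prod>i\<in>(UNIV::'n set). real (2 * b + 1) * T)"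
        using cardS by (intro prod_mono) auto
      also have "\<dots> = real (2 * b + 1) ^ r * T ^ r" by (simp add: r_def power_mult_distrib)
      also have "T ^ r = T ^ a * T powi (int r - int a)"
        using \<open>1 < T\<close> by (simp add: power_int_diff)
      also have "real (2 * b + 1) ^ r * (T ^ a * T powi (int r - int a)) \<le>
          real (2 * b + 1) ^ r * (real p0 ^ a * T powi (int r - int a))"
        using True P \<open>1 < T\<close> unfolding T_def[symmetric]
        by (intro mult_left_mono mult_right_mono power_mono) auto
      also have "\<dots> = c1 * T powi (int r - int a)" by (simp add: c1_def)
      also have "\<dots> \<le> (c1 + c2) * T powi (int r - int a)"
        using \<open>c2 \<ge> 0\<close> \<open>1 < T\<close> by (intro mult_right_mono) auto
      finally show ?thesis .
    next
      case False
      then have "p > p0" using p(2) by linarith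
      have "card (F p) \<le> card {y\<in>?box. \<forall>J\<subseteq>UNIV. card J = k \<longrightarrow> int p dvd eval_int_mpoly (g J) (?vec y)}"
        unfolding F_def using finbox by (simp add: card_image_le)
      then have "real (card (F p)) \<le>
          real (card {y\<in>?box. \<forall>J\<subseteq>UNIV. card J = k \<longrightarrow> int p dvd eval_int_mpoly (g J) (?vec y)})"
        by (simp only: of_nat_le_iff)
      also have "\<dots> \<le> real (D * (2 * b + 1) + 1) ^ card (UNIV::'n set) *
          (if k = 0 then 0 else (real (2 * b + 1) * T) ^ (k - 1))"
      proof (rule card_common_zeros_mod_prime[OF p(1)])
        show "finite (?S i)" "real (card (?S i)) \<le> real (2 * b + 1) * T" for i
          using card_residue_box(1)[OF m T] cardS by auto
        have "1 * 1 \<le> real (2 * b + 1) * T" using \<open>1 < T\<close> by (intro mult_mono) auto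
        then show "1 \<le> real (2 * b + 1) * T" by simp
        show "card {t\<in>?S i. t mod int p = q} \<le> 2 * b + 1" for i q
          using P p by (intro card_residue_box_class[OF m T]) auto
        show "g J \<in> polys_in J" "max_degree_le D (g J)"
          "\<exists>e. \<not> int p dvd Poly_Mapping.lookup (g J) e" if "card J = k" for J
          using g(2)[OF that] D[OF that] not_dvd[OF that \<open>p > p0\<close>] by auto
      qed
      also have "\<dots> \<le> c2 * T powi (int r - int a)"
      proof (cases "k = 0")
        case False
        then have "int (k - 1) = int r - int a" by (simp add: k_def r_def)
        then have "T ^ (k - 1) = T powi (int r - int a)" by (metis power_int_of_nat)
        then show ?thesis using False by (simp add: c2_def r_def power_mult_distrib)
      qed (use \<open>c2 \<ge> 0\<close> \<open>1 < T\<close> in simp)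
      also have "\<dots> \<le> (c1 + c2) * T powi (int r - int a)"
        using \<open>c1 \<ge> 0\<close> \<open>1 < T\<close> by (intro mult_right_mono) auto
      finally show ?thesis .
    qed
    have N: "(c1 + c2) * T powi (int r - int a) \<ge> 0"
      using \<open>c1 \<ge> 0\<close> \<open>c2 \<ge> 0\<close> \<open>1 < T\<close> by simp
    note bound = card_sieve_set_le[of F P m "(c1 + c2) * T powi (int r - int a)" B I lam x0,
        OF finF cardF sub \<open>P > 0\<close> N]
    have "1 \<le> real m" using m by simp
    moreover have "real m < lam" using T m by (simp add: field_simps)
    ultimately have "1 \<le> lam powr \<epsilon>" using \<open>\<epsilon> > 0\<close> by (intro ge_one_powr_ge_zero) auto
    have "real (card (sieve_set B I lam m x0 P)) \<le> 2 * P * ((c1 + c2) * T powi (int r - int a)) * 1"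
      using bound by simp
    also have "\<dots> \<le> 2 * P * ((c1 + c2) * T powi (int r - int a)) * lam powr \<epsilon>"
      using \<open>1 \<le> lam powr \<epsilon>\<close> mult_nonneg_nonneg[OF _ N, of "2 * P"] \<open>P > 0\<close>
      by (intro mult_left_mono) auto
    also have "\<dots> = 2 * (c1 + c2) * ((lam / real m) powi (int CARD('n) - int a) * P * lam powr \<epsilon>)"
      by (simp only: T_def r_def mult_ac)
    finally show "finite (sieve_set B I lam m x0 P) \<and>
        real (card (sieve_set B I lam m x0 P)) \<le>
          2 * (c1 + c2) * ((lam / real m) powi (int CARD('n) - int a) * P * lam powr \<epsilon>)"
      using bound by simp
  qed
qed

end
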